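(* Let $\gamma$ be an oval with outer length billiard map $F$, and fix an origin $O$ in the interior of $\gamma$. For every positive integer $k$ there is a constant $\rho=\rho(k,\gamma)$ such that every point $z$ in the exterior of $\gamma$ with $F^k(z)=z$ satisfies $|z|\le\rho$. That is, $F$ has no $k$-periodic orbits outside the disc of radius $\rho$ centered at $O$.
   Context: An oval is a smooth closed simple planar curve $\gamma$ with everywhere positive curvature; it bounds a compact strictly convex domain $K$. Orient $\gamma$ counterclockwise. For a point $A\in\mathbb{R}^2\setminus K$ there are exactly two lines through $A$ tangent to $\gamma$. The positive tangency point $x_+(A)$ is the one for which $x_+(A)-A$ is a positive multiple of the oriented tangent vector of $\gamma$ at $x_+(A)$. The negative tangency point $x_-(A)$ is the one for which $A-x_-(A)$ is a positive multiple of the oriented tangent vector of $\gamma$ at $x_-(A)$. Outer length billiard map $F:\mathbb{R}^2\setminus K\to\mathbb{R}^2\setminus K$. Let $\Sigma_A$ be the circle that is inscribed in the angle with vertex $A$ formed by the ray from $A$ through $x_+(A)$ and the ray from $A$ opposite to the ray from $A$ through $x_-(A)$, and that touches the first ray at $x_+(A)$. Then $\Sigma_A$ and $\gamma$ touch externally at $x_+(A)$. They have exactly three common tangent lines, two of which are the lines $Ax_+(A)$ and $Ax_-(A)$. $F(A)$ is the intersection point of the third common tangent line with the line $Ax_+(A)$. *)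

theory Defs
  imports "HOL-Analysis.Analysis"
begin

text \<open>The plane is modelled by the complex numbers. For vectors u, v the
determinant det(u,v) is Im (cnj u * v) and the inner product is Re (cnj u * v).\<close>

definition smooth_curve :: "(real \<Rightarrow> complex) \<Rightarrow> bool" where
  "smooth_curve \<gamma> \<longleftrightarrow>
     (\<exists>D :: nat \<Rightarrow> real \<Rightarrow> complex. D 0 = \<gamma> \<and>
        (\<forall>n t. (D n has_vector_derivative D (Suc n) t) (at t)))"

definition vel :: "(real \<Rightarrow> complex) \<Rightarrow> real \<Rightarrow> complex" where
  "vel \<gamma> t = vector_derivative \<gamma> (at t)"

definition acc :: "(real \<Rightarrow> complex) \<Rightarrow> real \<Rightarrow> complex" where
  "acc \<gamma> t = vector_derivative (vel \<gamma>) (at t)"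

text \<open>An oval, given by a 1-periodic smooth parametrisation which is simple
(injective on one period) and has everywhere positive signed curvature,
i.e. it is oriented counterclockwise.\<close>
definition oval :: "(real \<Rightarrow> complex) \<Rightarrow> bool" where
  "oval \<gamma> \<longleftrightarrow> smooth_curve \<gamma> \<and> (\<forall>t. \<gamma> (t + 1) = \<gamma> t) \<and> inj_on \<gamma> {0..<1} \<and>
     (\<forall>t. Im (cnj (vel \<gamma> t) * acc \<gamma> t) > 0)"

definition oval_domain :: "(real \<Rightarrow> complex) \<Rightarrow> complex set" where
  "oval_domain \<gamma> = range \<gamma> \<union> inside (range \<gamma>)"

definition x_plus :: "(real \<Rightarrow> complex) \<Rightarrow> complex \<Rightarrow> complex" where
  "x_plus \<gamma> A = (THE x. \<exists>t. x = \<gamma> t \<and> (\<exists>c>0. x - A = of_real c * vel \<gamma> t))"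

definition x_minus :: "(real \<Rightarrow> complex) \<Rightarrow> complex \<Rightarrow> complex" where
  "x_minus \<gamma> A = (THE x. \<exists>t. x = \<gamma> t \<and> (\<exists>c>0. A - x = of_real c * vel \<gamma> t))"

definition line_through :: "complex \<Rightarrow> complex \<Rightarrow> complex set" where
  "line_through p q = {p + of_real s * (q - p) | s. True}"

definition curve_tangent_line :: "(real \<Rightarrow> complex) \<Rightarrow> complex set \<Rightarrow> bool" where
  "curve_tangent_line \<gamma> L \<longleftrightarrow> (\<exists>t. L = {\<gamma> t + of_real s * vel \<gamma> t | s. True})"

definition circle_tangent_line :: "complex \<Rightarrow> real \<Rightarrow> complex set \<Rightarrow> bool" where
  "circle_tangent_line c r L \<longleftrightarrow>
     (\<exists>p v. v \<noteq> 0 \<and> L = {p + of_real s * v | s. True} \<and> cmod (p - c) = r \<and>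
            Re (cnj (p - c) * v) = 0)"

text \<open>The circle Sigma_A (centre c, radius r): inscribed in the angle at A formed
by the ray from A through x_+(A) and the ray from A opposite to the ray through
x_-(A), touching the first ray at x_+(A) (and the second ray at some point of it).\<close>
definition sigma_circle :: "(real \<Rightarrow> complex) \<Rightarrow> complex \<Rightarrow> complex \<Rightarrow> real \<Rightarrow> bool" where
  "sigma_circle \<gamma> A c r \<longleftrightarrow>
     (let xp = x_plus \<gamma> A; xm = x_minus \<gamma> A in
       r > 0 \<and> cmod (c - xp) = r \<and> Re (cnj (c - xp) * (xp - A)) = 0 \<and>
       (\<exists>s>0. cmod (c - (A + of_real s * (A - xm))) = r \<and>
              Re (cnj (c - (A + of_real s * (A - xm))) * (A - xm)) = 0))"

definition outer_length_billiard :: "(real \<Rightarrow> complex) \<Rightarrow> complex \<Rightarrow> complex" where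
  "outer_length_billiard \<gamma> A =
     (THE B. \<exists>c r L. sigma_circle \<gamma> A c r \<and> circle_tangent_line c r L \<and>
        curve_tangent_line \<gamma> L \<and>
        L \<noteq> line_through A (x_plus \<gamma> A) \<and> L \<noteq> line_through A (x_minus \<gamma> A) \<and>
        B \<in> L \<and> B \<in> line_through A (x_plus \<gamma> A))"

end

theory Submission
  imports Defs
begin

text \<open>A simple closed curve of positive curvature has rotation number one, so it lies strictly to the
  left of all its tangents. For a distant point \<open>A\<close>, put the origin at \<open>x\<^sub>+(A)\<close> and the first axis along
  the oriented tangent there, so that \<open>A = -a\<close>. The circle has a radius \<open>r \<ge> a\<close> and lies below the axis;
  convexity shows that just one common tangent of the circle and the curve crosses the axis upwards,
  and it does so at \<open>F(A) = x > 0\<close>, where \<open>x\<close> tends to infinity with \<open>r\<close>. Seen from the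
  interior point \<open>O\<close>, the step from \<open>A\<close> to \<open>F(A)\<close> runs along a line with \<open>O\<close> on its left at a
  bounded positive distance, and both end points are far away: it turns by \<open>\<pi> - \<delta>\<close> with \<open>\<delta> > 0\<close>
  small. After \<open>k\<close> steps the total turn is \<open>k \<pi> - \<Delta>\<close> with \<open>0 < \<Delta> < \<pi>\<close>, which is not a multiple of
  \<open>\<pi>\<close>.\<close>

text \<open>Positive curvature alone allows closed curves that wind several times and are not
  convex; injectivity on one period excludes them, which is why a rotation number has to be computed
  at all. The crossing point tends to infinity with \<open>r\<close> for this reason: from a bounded
  point of the axis, the upward tangent to a huge circle below the axis runs almost backwards, so
  its left side lies essentially below the axis and misses the interior point \<open>O\<close>,
  which has a fixed positive height above the axis. Distances from \<open>O\<close> are never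
  compared across a step. Each step is minus a positive factor times a clockwise rotation by
  \<delta>, and the factor stays unknown; far away \<delta> is as small as desired but never zero.
  For even \<open>k\<close> the iterate is close in direction to the identity, so smallness alone
  cannot rule out a fixed point and the strict sign of \<delta> decides.\<close>

locale oval_curve =
  fixes \<gamma> :: "real \<Rightarrow> complex"
  assumes oval: "oval \<gamma>"
begin

section \<open>Regularity and periodicity of the parametrisation\<close>

lemma deriv_curve: "(\<gamma> has_vector_derivative vel \<gamma> t) (at t)"
  and deriv_vel: "(vel \<gamma> has_vector_derivative acc \<gamma> t) (at t)"
proof -
  obtain D where D0: "D 0 = \<gamma>"
    and D: "\<And>n t. (D n has_vector_derivative D (Suc n) t) (at t)"
    using oval unfolding oval_def smooth_curve_def by blast
  have D1: "vel \<gamma> = D 1"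
    using D[of 0] by (auto simp: vel_def D0 fun_eq_iff intro!: vector_derivative_at)
  have D2: "acc \<gamma> = D 2"
    using D[of 1] by (auto simp: acc_def D1 fun_eq_iff numeral_2_eq_2 intro!: vector_derivative_at)
  show "(\<gamma> has_vector_derivative vel \<gamma> t) (at t)" using D[of 0 t] by (simp add: D0 D1)
  show "(vel \<gamma> has_vector_derivative acc \<gamma> t) (at t)"
    using D[of 1 t] by (simp add: D1 D2 numeral_2_eq_2)
qed

lemma curvature_pos: "Im (cnj (vel \<gamma> t) * acc \<gamma> t) > 0"
  using oval unfolding oval_def by blast

lemma vel_nonzero [simp]: "vel \<gamma> t \<noteq> 0"
  using curvature_pos[of t] by auto

lemma continuous_curve: "continuous_on S \<gamma>"
  using deriv_curve by (meson continuous_at_imp_continuous_on has_vector_derivative_continuous)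

lemma continuous_vel: "continuous_on S (vel \<gamma>)"
  using deriv_vel by (meson continuous_at_imp_continuous_on has_vector_derivative_continuous)

lemma periodic: "\<gamma> (t + 1) = \<gamma> t"
  using oval unfolding oval_def by blast

lemma periodic_int: "\<gamma> (t + of_int n) = \<gamma> t"
proof (induction n rule: int_induct[of _ 0])
  case (step1 i)
  then show ?case using periodic[of "t + of_int i"] by (simp add: add.assoc)
next
  case (step2 i)
  then show ?case using periodic[of "t + of_int (i - 1)"] by (simp add: add.assoc)
qed auto

lemma vel_periodic_int: "vel \<gamma> (t + of_int n) = vel \<gamma> t"
proof -
  have "((\<gamma> \<circ> (\<lambda>s. s + of_int n)) has_vector_derivative 1 *\<^sub>R vel \<gamma> (t + of_int n)) (at t)"
    by (rule vector_diff_chain_at) (auto intro!: derivative_eq_intros deriv_curve)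
  moreover have "\<gamma> \<circ> (\<lambda>s. s + of_int n) = \<gamma>"
    using periodic_int by (simp add: fun_eq_iff)
  ultimately show ?thesis
    using vector_derivative_unique_at[OF deriv_curve[of t]] by simp
qed

lemma acc_periodic: "acc \<gamma> (t + 1) = acc \<gamma> t"
proof -
  have "((vel \<gamma> \<circ> (\<lambda>s. s + 1)) has_vector_derivative 1 *\<^sub>R acc \<gamma> (t + 1)) (at t)"
    by (rule vector_diff_chain_at) (auto intro!: derivative_eq_intros deriv_vel)
  moreover have "vel \<gamma> \<circ> (\<lambda>s. s + 1) = vel \<gamma>"
    using vel_periodic_int[of _ 1] by (simp add: fun_eq_iff)
  ultimately show ?thesis
    using vector_derivative_unique_at[OF deriv_vel[of t]] by simp
qed

lemma curve_eq_iff: "\<gamma> s = \<gamma> t \<longleftrightarrow> (\<exists>n. s = t + of_int n)"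
proof
  assume eq: "\<gamma> s = \<gamma> t"
  have "\<gamma> (frac s) = \<gamma> s" "\<gamma> (frac t) = \<gamma> t"
    using periodic_int[of s "- \<lfloor>s\<rfloor>"] periodic_int[of t "- \<lfloor>t\<rfloor>"] by (simp_all add: frac_def)
  moreover have "inj_on \<gamma> {0..<1}"
    using oval unfolding oval_def by blast
  ultimately have "frac s = frac t"
    using eq by (auto simp: inj_on_def frac_lt_1)
  then have "s = t + of_int (\<lfloor>s\<rfloor> - \<lfloor>t\<rfloor>)"
    by (simp add: frac_def algebra_simps)
  then show "\<exists>n. s = t + of_int n" by blast
qed (auto simp: periodic_int)

lemma vel_cong: "\<gamma> s = \<gamma> t \<Longrightarrow> vel \<gamma> s = vel \<gamma> t"
  by (auto simp: curve_eq_iff vel_periodic_int)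

lemma curve_neq: "\<gamma> s \<noteq> \<gamma> t" if "s < t" "t < s + 1"
proof
  assume "\<gamma> s = \<gamma> t"
  then obtain n where n: "s = t + of_int n" using curve_eq_iff by blast
  then have "of_int n < (0::real)" "of_int n > (-1::real)" using that by auto
  then show False by simp
qed

subsection \<open>Rotation of the tangent\<close>

text \<open>Mean velocity between two parameters: the integral form extends the difference quotient
  continuously to the diagonal, with the velocity as value there.\<close>

definition secant :: "real \<times> real \<Rightarrow> complex" where
  "secant p = integral {0..1} (\<lambda>\<tau>. vel \<gamma> (fst p + \<tau> * (snd p - fst p)))"

lemma continuous_secant: "continuous_on S secant"
proof -
  have "continuous_on (S \<times> cbox 0 1) (\<lambda>(p, \<tau>). vel \<gamma> (fst p + \<tau> * (snd p - fst p)))"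
    unfolding case_prod_unfold
    by (rule continuous_on_compose2[OF continuous_vel[of UNIV]]) (auto intro!: continuous_intros)
  from integral_continuous_on_param[OF this] show ?thesis
    by (simp add: secant_def[abs_def])
qed

lemma secant_diagonal: "secant (t, t) = vel \<gamma> t"
  by (simp add: secant_def)

lemma secant_eq: "of_real (t - s) * secant (s, t) = \<gamma> t - \<gamma> s"
proof -
  have "((\<lambda>\<tau>. (t - s) *\<^sub>R vel \<gamma> (s + \<tau> * (t - s))) has_integral
      (\<gamma> (s + 1 * (t - s)) - \<gamma> (s + 0 * (t - s)))) {0..1}"
  proof (rule fundamental_theorem_of_calculus)
    fix \<tau> :: real
    have "((\<gamma> \<circ> (\<lambda>\<tau>. s + \<tau> * (t - s))) has_vector_derivative
        (t - s) *\<^sub>R vel \<gamma> (s + \<tau> * (t - s))) (at \<tau>)"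
      by (rule vector_diff_chain_at) (auto intro!: derivative_eq_intros deriv_curve
          simp: has_real_derivative_iff_has_vector_derivative[symmetric])
    then show "((\<lambda>\<tau>. \<gamma> (s + \<tau> * (t - s))) has_vector_derivative
        (t - s) *\<^sub>R vel \<gamma> (s + \<tau> * (t - s))) (at \<tau> within {0..1})"
      by (auto simp: o_def intro: has_vector_derivative_at_within)
  qed auto
  from integral_unique[OF this]
  have "integral {0..1} (\<lambda>\<tau>. (t - s) *\<^sub>R vel \<gamma> (s + \<tau> * (t - s))) = \<gamma> t - \<gamma> s"
    by simp
  then show ?thesis by (simp add: secant_def scaleR_conv_of_real)
qed

lemma secant_nonzero: "secant (s, t) \<noteq> 0" if "s \<le> t" "t < s + 1"
proof (cases "s = t")
  case False
  then have "\<gamma> s \<noteq> \<gamma> t" using curve_neq that by simp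
  then show ?thesis using secant_eq[of t s] by auto
qed (simp add: secant_diagonal)

end

section \<open>Continuous arguments and logarithms\<close>

text \<open>The image of a connected set is an interval; to leave \<open>{0..pi}\<close> it would
  have to pass through values just below 0 or just above \<pi>, where the sine is negative.\<close>

lemma sin_nonneg_stays_in_half_turn:
  fixes f :: "'a::topological_space \<Rightarrow> real"
  assumes "connected S" "continuous_on S f" and sin: "\<And>x. x \<in> S \<Longrightarrow> sin (f x) \<ge> 0"
    and "a \<in> S" "f a \<in> {0..pi}" "x \<in> S"
  shows "f x \<in> {0..pi}"
proof (rule ccontr)
  assume "f x \<notin> {0..pi}"
  have conn: "connected (f ` S)" using assms connected_continuous_image by blast
  consider "f x < 0" | "f x > pi" using \<open>f x \<notin> _\<close> by force
  then show False
  proof cases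
    case 1
    \<comment> \<open>The truncation keeps the intermediate value inside the first negative arch of
      the sine, however far \<open>f x\<close> has moved.\<close>
    define y where "y = max (f x) (- pi / 2)"
    have y: "-pi < y" "y < 0" "f x \<le> y" using 1 pi_gt_zero unfolding y_def by linarith+
    have "y \<in> f ` S"
      using connectedD_interval[OF conn, of "f x" "f a" y] assms y by auto
    then have "sin y \<ge> 0" using sin by auto
    then show False using sin_gt_zero[of "- y"] y by simp
  next
    case 2
    define y where "y = min (f x) (3 * pi / 2)"
    have y: "pi < y" "y < 2 * pi" "y \<le> f x" using 2 pi_gt_zero unfolding y_def by linarith+
    have "y \<in> f ` S"
      using connectedD_interval[OF conn, of "f a" "f x" y] assms y by auto
    then have "sin y \<ge> 0" using sin by auto
    then show False using sin_gt_zero[of "y - pi"] y by (simp add: sin_diff)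
  qed
qed

text \<open>Near \<open>t\<close> a continuous logarithm moves by less than \<pi> in imaginary part,
  so it coincides with the principal branch of \<open>f s / f t\<close> up to the constant
  \<open>l t\<close>, and that branch is differentiable.\<close>

lemma continuous_log_has_derivative:
  fixes f l :: "real \<Rightarrow> complex"
  assumes "continuous (at t) l" and f: "\<And>s. f s = exp (l s)"
    and f': "(f has_vector_derivative f') (at t)"
  shows "(l has_vector_derivative f' / f t) (at t)"
proof -
  have "((\<lambda>s. f s / f t) has_vector_derivative f' / f t) (at t)"
    using f' by (auto intro!: derivative_eq_intros)
  then have "((Ln \<circ> (\<lambda>s. f s / f t)) has_vector_derivative (f' / f t) * 1) (at t)"
    by (rule field_vector_diff_chain_at)
       (auto simp: f intro!: derivative_eq_intros)
  then have "((\<lambda>s. Ln (f s / f t) + l t) has_vector_derivative f' / f t) (at t)"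
    by (auto simp: o_def intro!: derivative_eq_intros)
  moreover have "eventually (\<lambda>s. Ln (f s / f t) + l t = l s) (nhds t)"
  proof -
    have "(l \<longlongrightarrow> l t) (nhds t)"
      using assms(1) by (simp add: continuous_at tendsto_at_iff_tendsto_nhds)
    then have "eventually (\<lambda>s. dist (l s) (l t) < pi) (nhds t)"
      using tendstoD pi_gt_zero by blast
    then show ?thesis
    proof eventually_elim
      case (elim s)
      then have "\<bar>Im (l s - l t)\<bar> < pi"
        using abs_Im_le_cmod[of "l s - l t"] by (simp add: dist_norm)
      then have "Ln (exp (l s - l t)) = l s - l t" by (intro Ln_exp) auto
      then show ?case by (simp add: f exp_diff)
    qed
  qed
  moreover from this have "Ln (f t / f t) + l t = l t"
    by (rule eventually_nhds_x_imp_x)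
  ultimately show ?thesis
    by (subst has_vector_derivative_cong_ev[symmetric, where f = "\<lambda>s. Ln (f s / f t) + l t"])
       (auto elim: eventually_mono)
qed

context oval_curve
begin

lemma deriv_linear_curve:
  "((\<lambda>t. Re (w * \<gamma> t)) has_real_derivative Re (w * vel \<gamma> t)) (at t)"
  "((\<lambda>t. Im (w * \<gamma> t)) has_real_derivative Im (w * vel \<gamma> t)) (at t)"
proof -
  have "((\<lambda>t. w * \<gamma> t) has_vector_derivative w * vel \<gamma> t) (at t)"
    by (auto intro!: derivative_eq_intros deriv_curve)
  then show "((\<lambda>t. Re (w * \<gamma> t)) has_real_derivative Re (w * vel \<gamma> t)) (at t)"
    "((\<lambda>t. Im (w * \<gamma> t)) has_real_derivative Im (w * vel \<gamma> t)) (at t)"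
    by (rule has_field_derivative_Re has_field_derivative_Im)+
qed

lemma attains_min:
  fixes f :: "complex \<Rightarrow> real"
  assumes "continuous_on (range \<gamma>) f"
  obtains b where "\<And>t. f (\<gamma> b) \<le> f (\<gamma> t)"
proof -
  have "continuous_on {0..1} (\<lambda>t. f (\<gamma> t))"
    by (rule continuous_on_compose2[OF assms continuous_curve]) auto
  then have "\<exists>b\<in>{0..1}. \<forall>t\<in>{0..1}. f (\<gamma> b) \<le> f (\<gamma> t)"
    by (intro continuous_attains_inf) auto
  then obtain b where b: "\<And>t. t \<in> {0..1} \<Longrightarrow> f (\<gamma> b) \<le> f (\<gamma> t)" by blast
  have "f (\<gamma> b) \<le> f (\<gamma> t)" for t
  proof -
    have "\<gamma> (frac t) = \<gamma> t"
      using periodic_int[of t "- \<lfloor>t\<rfloor>"] by (simp add: frac_def)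
    then show ?thesis using b[of "frac t"] by (simp add: frac_lt_1 less_imp_le)
  qed
  then show ?thesis using that by blast
qed

text \<open>Hopf's Umlaufsatz: the secant directions have a continuous argument on the strip
  \<open>s \<le> t < s + 1\<close>. At a lowest point \<open>b\<close> the secants from \<open>b\<close> stay in the upper half plane and those
  to \<open>b + 1\<close> in the lower one, so the argument gains \<open>\<pi>\<close> along each of these two edges.\<close>
lemma tangent_angle_exists:
  "\<exists>\<theta>. continuous_on UNIV \<theta> \<and> strict_mono \<theta> \<and> (\<forall>t. \<theta> (t + 1) = \<theta> t + 2 * pi) \<and>
     (\<forall>t. vel \<gamma> t = of_real (cmod (vel \<gamma> t)) * cis (\<theta> t))"
proof -
  \<comment> \<open>The strip is convex, hence contractible, which yields a continuous logarithm.
    The bound \<open>t < s + 1\<close> is strict because the secant vanishes on the line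
    \<open>t = s + 1\<close>.\<close>
  define S where "S = {p :: real \<times> real. fst p \<le> snd p \<and> snd p < fst p + 1}"
  have "S = {p. (1, -1) \<bullet> p \<le> 0} \<inter> {p. (-1, 1) \<bullet> p < 1}"
    by (auto simp: S_def inner_prod_def)
  then have "convex S"
    by (simp add: convex_Int convex_halfspace_le convex_halfspace_lt)
  then have "contractible S" by (rule convex_imp_contractible)
  then obtain \<Lambda> where \<Lambda>: "continuous_on S \<Lambda>" and sec: "\<And>p. p \<in> S \<Longrightarrow> secant p = exp (\<Lambda> p)"
    by (rule continuous_logarithm_on_contractible[OF continuous_secant])
       (auto simp: S_def secant_nonzero)
  define \<Theta> where "\<Theta> p = Im (\<Lambda> p)" for p
  have cont_\<Theta>: "continuous_on S \<Theta>"
    unfolding \<Theta>_def[abs_def] by (intro continuous_intros \<Lambda>)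
  have Re_sec: "Re (secant p) = exp (Re (\<Lambda> p)) * cos (\<Theta> p)"
    and Im_sec: "Im (secant p) = exp (Re (\<Lambda> p)) * sin (\<Theta> p)" if "p \<in> S" for p
    using sec[OF that] by (auto simp: \<Theta>_def Re_exp Im_exp)
  define l where "l t = \<Lambda> (t, t)" for t
  define \<theta> where "\<theta> t = Im (l t)" for t
  have diag: "(t, t) \<in> S" for t by (simp add: S_def)
  have vel: "vel \<gamma> t = exp (l t)" for t
    using sec[OF diag] by (simp add: l_def secant_diagonal)
  have Re_vel: "Re (vel \<gamma> t) = exp (Re (l t)) * cos (\<theta> t)"
    and Im_vel: "Im (vel \<gamma> t) = exp (Re (l t)) * sin (\<theta> t)" for t
    by (auto simp: \<theta>_def vel Re_exp Im_exp)
  have cont_l: "continuous_on UNIV l"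
    unfolding l_def[abs_def]
    by (rule continuous_on_compose2[OF \<Lambda>]) (auto intro!: continuous_intros simp: diag)
  have cont_\<theta>: "continuous_on UNIV \<theta>"
    unfolding \<theta>_def[abs_def] by (intro continuous_intros cont_l)
  define \<kappa> where "\<kappa> t = Im (acc \<gamma> t / vel \<gamma> t)" for t
  have d\<theta>: "(\<theta> has_real_derivative \<kappa> t) (at t)" for t
    unfolding \<theta>_def[abs_def] \<kappa>_def
    by (intro has_field_derivative_Im continuous_log_has_derivative vel deriv_vel)
       (use cont_l in \<open>auto simp: continuous_on_eq_continuous_at\<close>)
  have \<kappa>_pos: "\<kappa> t > 0" for t
  proof -
    have "\<kappa> t = Im (cnj (vel \<gamma> t) * acc \<gamma> t) / (cmod (vel \<gamma> t))\<^sup>2"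
      by (simp add: \<kappa>_def Im_divide cmod_def)
    then show ?thesis using curvature_pos[of t] by simp
  qed
  have mono: "strict_mono \<theta>"
    by (intro strict_monoI DERIV_pos_imp_increasing[where f = \<theta>]) (use d\<theta> \<kappa>_pos in blast)+
  \<comment> \<open>The rate of turning is periodic, so the turn over one period does not depend on
    where it starts and may be computed at the lowest point.\<close>
  have shift: "\<theta> (t + 1) - \<theta> t = \<theta> (s + 1) - \<theta> s" for s t
  proof (rule DERIV_isconst_all[where f = "\<lambda>t. \<theta> (t + 1) - \<theta> t"], rule allI)
    fix x
    have "((\<lambda>t. \<theta> (t + 1)) has_real_derivative \<kappa> (x + 1)) (at x)"
      by (rule DERIV_shift[THEN iffD1, OF d\<theta>])
    moreover have "\<kappa> (x + 1) = \<kappa> x"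
      using vel_periodic_int[of x 1] by (simp add: \<kappa>_def acc_periodic)
    ultimately show "((\<lambda>t. \<theta> (t + 1) - \<theta> t) has_real_derivative 0) (at x)"
      using d\<theta>[of x] by (auto intro!: derivative_eq_intros)
  qed
  obtain b where b: "\<And>t. Im (\<gamma> b) \<le> Im (\<gamma> t)"
    by (rule attains_min[of Im]) (auto intro!: continuous_intros)
  have "Im (1 * vel \<gamma> b) = 0"
    by (rule DERIV_local_min[OF deriv_linear_curve(2)[of 1 b], of 1]) (use b in auto)
  then have sin_b: "sin (\<theta> b) = 0" by (simp add: Im_vel)
  \<comment> \<open>Were the velocity at the lowest point directed to the left, the increasing angle
    would turn it downwards immediately afterwards, and the curve would go below its
    minimum.\<close>
  have Re_vel_b: "Re (vel \<gamma> b) > 0"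
  proof (rule ccontr)
    assume "\<not> Re (vel \<gamma> b) > 0"
    then have "cos (\<theta> b) \<le> 0" by (simp add: Re_vel mult_le_0_iff zero_less_mult_iff not_less)
    then have cos_b: "cos (\<theta> b) = - 1" using sin_b sin_cos_squared_add[of "\<theta> b"]
      by (auto simp: power2_eq_1_iff)
    have "isCont \<theta> b" using cont_\<theta> continuous_on_eq_continuous_at by blast
    then obtain d where d: "d > 0" "\<And>t. \<bar>t - b\<bar> < d \<Longrightarrow> \<bar>\<theta> t - \<theta> b\<bar> < pi"
      unfolding continuous_at_eps_delta dist_real_def using pi_gt_zero by blast
    have "Im (1 * \<gamma> (b + d / 2)) < Im (1 * \<gamma> b)"
    proof (rule DERIV_neg_imp_decreasing_open[where f = "\<lambda>t. Im (1 * \<gamma> t)"])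
      fix x assume x: "b < x" "x < b + d / 2"
      then have "0 < \<theta> x - \<theta> b" "\<theta> x - \<theta> b < pi"
        using strict_monoD[OF mono, of b x] d(1) d(2)[of x] by (auto simp: abs_less_iff)
      then have "sin (\<theta> x - \<theta> b) > 0" by (rule sin_gt_zero)
      then have "Im (1 * vel \<gamma> x) < 0"
        by (simp add: Im_vel sin_diff sin_b cos_b mult_pos_neg)
      then show "\<exists>y. ((\<lambda>t. Im (1 * \<gamma> t)) has_real_derivative y) (at x) \<and> y < 0"
        using deriv_linear_curve(2) by blast
    next
      show "continuous_on {b..b + d / 2} (\<lambda>t. Im (1 * \<gamma> t))"
        by (intro continuous_intros continuous_curve)
    qed (use d in auto)
    then show False using b[of "b + d / 2"] by simp
  qed
  then have "cos (\<theta> b) > 0" by (simp add: Re_vel zero_less_mult_iff)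
  then have cos_b: "cos (\<theta> b) = 1" using sin_b sin_cos_squared_add[of "\<theta> b"]
    by (auto simp: power2_eq_1_iff)
  have Im_nonneg: "Im (secant (b, t)) \<ge> 0" if "b \<le> t" for t
  proof (cases "b = t")
    case True
    then show ?thesis by (simp add: secant_diagonal Im_vel sin_b flip: True)
  next
    case False
    have "(t - b) * Im (secant (b, t)) = Im (\<gamma> t - \<gamma> b)"
      using arg_cong[OF secant_eq[of t b], of Im] by simp
    then have "0 \<le> (t - b) * Im (secant (b, t))" using b[of t] by simp
    then show ?thesis using False that by (simp add: zero_le_mult_iff)
  qed
  have Im_nonpos: "Im (secant (s, b + 1)) \<le> 0" if "s \<le> b + 1" for s
  proof (cases "s = b + 1")
    case True
    then show ?thesis using vel_periodic_int[of b 1] by (simp add: secant_diagonal Im_vel sin_b)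
  next
    case False
    have "(b + 1 - s) * Im (secant (s, b + 1)) = Im (\<gamma> b - \<gamma> s)"
      using arg_cong[OF secant_eq[of "b + 1" s], of Im] periodic[of b] by simp
    then have "(b + 1 - s) * Im (secant (s, b + 1)) \<le> 0" using b[of s] by simp
    then show ?thesis using False that by (simp add: mult_le_0_iff)
  qed
  have left: "\<Theta> (b, t) - \<theta> b \<in> {0..pi}" if t: "b \<le> t" "t < b + 1" for t
  proof (rule sin_nonneg_stays_in_half_turn[where S = "{b..<b+1}" and a = b
        and f = "\<lambda>t. \<Theta> (b, t) - \<theta> b"])
    show "continuous_on {b..<b + 1} (\<lambda>t. \<Theta> (b, t) - \<theta> b)"
      by (intro continuous_intros continuous_on_compose2[OF cont_\<Theta>]) (auto simp: S_def)
    fix x assume x: "x \<in> {b..<b + 1}"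
    then have "sin (\<Theta> (b, x)) \<ge> 0"
      using Im_nonneg[of x] Im_sec[of "(b, x)"] by (simp add: S_def zero_le_mult_iff)
    then show "sin (\<Theta> (b, x) - \<theta> b) \<ge> 0" by (simp add: sin_diff sin_b cos_b)
  qed (use t in \<open>auto simp: \<Theta>_def \<theta>_def l_def\<close>)
  obtain d where d: "0 < d" "d < 1" "\<And>t. \<bar>t - b\<bar> < d \<Longrightarrow> Re (vel \<gamma> t) > 0"
  proof -
    have "isCont (\<lambda>t. Re (vel \<gamma> t)) b"
      using continuous_vel[of UNIV] by (auto simp: continuous_on_eq_continuous_at intro!: continuous_intros)
    then obtain d where "d > 0" "\<And>t. \<bar>t - b\<bar> < d \<Longrightarrow> \<bar>Re (vel \<gamma> t) - Re (vel \<gamma> b)\<bar> < Re (vel \<gamma> b)"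
      unfolding continuous_at_eps_delta dist_real_def using Re_vel_b by blast
    then show ?thesis by (intro that[of "min d (1/2)"]) (force simp: abs_less_iff)+
  qed
  \<comment> \<open>Close to the corner \<open>(b, b + 1)\<close> of the strip the secant direction is almost opposite to
    the velocity at \<open>b\<close>; this links the two half turns made along the edges.\<close>
  define C where "C = {p \<in> S. b \<le> fst p \<and> snd p \<le> b + 1 \<and> fst p + 1 < snd p + d}"
  have "C = S \<inter> {p. (1, 0) \<bullet> p \<ge> b} \<inter> {p. (0, 1) \<bullet> p \<le> b + 1} \<inter> {p. (1, -1) \<bullet> p < d - 1}"
    by (auto simp: C_def inner_prod_def)
  then have "convex C"
    by (simp add: convex_Int \<open>convex S\<close> convex_halfspace_le convex_halfspace_lt convex_halfspace_ge)
  then have "connected C" by (rule convex_connected)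
  have C_neg: "cos (\<Theta> p) < 0" if "p \<in> C" for p
  proof -
    obtain s t where p: "p = (s, t)" by (cases p)
    have st: "b \<le> s" "t \<le> b + 1" "s + 1 < t + d" "s \<le> t" "t < s + 1" and pS: "p \<in> S"
      using that by (auto simp: p C_def S_def)
    \<comment> \<open>Both \<open>t - 1\<close> and \<open>s\<close> are within \<open>d\<close> of
      \<open>b\<close>, where the curve moves to the right; by periodicity the secant from
      \<open>s\<close> to \<open>t\<close> therefore points to the left.\<close>
    have "Re (1 * \<gamma> (t - 1)) < Re (1 * \<gamma> s)"
    proof (rule DERIV_pos_imp_increasing_open[where f = "\<lambda>t. Re (1 * \<gamma> t)"])
      fix x assume "t - 1 < x" "x < s"
      then have "Re (1 * vel \<gamma> x) > 0" using st d(3)[of x] by (auto simp: abs_less_iff)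
      then show "\<exists>y. ((\<lambda>t. Re (1 * \<gamma> t)) has_real_derivative y) (at x) \<and> y > 0"
        using deriv_linear_curve(1) by blast
    qed (use st in \<open>auto intro!: continuous_intros continuous_curve\<close>)
    then have "Re (\<gamma> t - \<gamma> s) < 0" using periodic[of "t - 1"] by simp
    moreover have "(t - s) * Re (secant p) = Re (\<gamma> t - \<gamma> s)"
      using arg_cong[OF secant_eq[of t s], of Re] by (simp add: p)
    ultimately have "Re (secant p) < 0"
      using \<open>s \<le> t\<close> by (metis diff_ge_0_iff_ge mult_less_0_iff not_less)
    then show ?thesis using Re_sec[OF pS] by (simp add: mult_less_0_iff)
  qed
  have corner1: "(b, b + 1 - d / 2) \<in> C" and corner2: "(b + d / 2, b + 1) \<in> C"
    using d by (auto simp: C_def S_def)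
  \<comment> \<open>Shifting by \<pi>/2 turns the negative cosine into a nonnegative sine. The first
    edge supplies the starting value that selects the right branch.\<close>
  have corner: "\<Theta> p - \<theta> b - pi / 2 \<in> {0..pi}" if "p \<in> C" for p
  proof (rule sin_nonneg_stays_in_half_turn[where S = C and a = "(b, b + 1 - d / 2)"
        and f = "\<lambda>p. \<Theta> p - \<theta> b - pi / 2"])
    show "continuous_on C (\<lambda>p. \<Theta> p - \<theta> b - pi / 2)"
      by (intro continuous_intros continuous_on_subset[OF cont_\<Theta>]) (auto simp: C_def)
    show "sin (\<Theta> p - \<theta> b - pi / 2) \<ge> 0" if "p \<in> C" for p
      using C_neg[OF that] by (simp add: sin_diff sin_b cos_b cos_diff)
    define y where "y = \<Theta> (b, b + 1 - d / 2) - \<theta> b"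
    have "y \<in> {0..pi}" using left[of "b + 1 - d / 2"] d by (simp add: y_def)
    moreover have "cos y < 0" using C_neg[OF corner1] by (simp add: y_def cos_diff sin_b cos_b)
    ultimately show "\<Theta> (b, b + 1 - d / 2) - \<theta> b - pi / 2 \<in> {0..pi}"
      using cos_ge_zero[of y] by (auto simp: y_def[symmetric] not_less[symmetric])
  qed (use \<open>connected C\<close> corner1 that in auto)
  \<comment> \<open>Secants on this edge point downwards, which confines the angle to one half turn;
    the value inherited from the corner shows that it is the second one.\<close>
  have right: "\<Theta> (s, b + 1) - \<theta> b - pi \<in> {0..pi}" if s: "b < s" "s \<le> b + 1" for s
  proof (rule sin_nonneg_stays_in_half_turn[where S = "{b<..b+1}" and a = "b + d / 2"
        and f = "\<lambda>s. \<Theta> (s, b + 1) - \<theta> b - pi"])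
    show "continuous_on {b<..b + 1} (\<lambda>s. \<Theta> (s, b + 1) - \<theta> b - pi)"
      by (intro continuous_intros continuous_on_compose2[OF cont_\<Theta>]) (auto simp: S_def)
    show *: "sin (\<Theta> (x, b + 1) - \<theta> b - pi) \<ge> 0" if x: "x \<in> {b<..b + 1}" for x
    proof -
      have "sin (\<Theta> (x, b + 1)) \<le> 0"
        using Im_nonpos[of x] Im_sec[of "(x, b + 1)"] x by (simp add: S_def mult_le_0_iff)
      then show ?thesis by (simp add: sin_diff sin_b cos_b)
    qed
    define y where "y = \<Theta> (b + d / 2, b + 1) - \<theta> b - pi / 2"
    have y: "y \<in> {0..pi}" using corner[OF corner2] by (simp add: y_def)
    have "sin (y - pi / 2) \<ge> 0"
      using *[of "b + d / 2"] d by (simp add: y_def algebra_simps)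
    then have "cos y \<le> 0" by (simp add: sin_diff)
    then have "\<not> y < pi / 2" using cos_gt_zero_pi[of y] y by auto
    then show "\<Theta> (b + d / 2, b + 1) - \<theta> b - pi \<in> {0..pi}"
      using y by (auto simp: y_def)
  qed (use s d in auto)
  \<comment> \<open>The angle gained lies between \<pi> and 2\<pi>, and the velocity has returned to
    itself, so only 2\<pi> remains.\<close>
  have "\<theta> (b + 1) - \<theta> b = 2 * pi"
  proof -
    define y where "y = \<theta> (b + 1) - \<theta> b - pi"
    have y: "y \<in> {0..pi}" using right[of "b + 1"] by (simp add: y_def \<Theta>_def \<theta>_def l_def)
    have "vel \<gamma> (b + 1) = vel \<gamma> b" using vel_periodic_int[of b 1] by simp
    then have "cos (\<theta> (b + 1)) > 0" "sin (\<theta> (b + 1)) = 0"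
      using Re_vel[of "b + 1"] Im_vel[of "b + 1"] Re_vel_b
      by (auto simp: zero_less_mult_iff Im_vel sin_b)
    then have "sin y = 0" "cos y < 0"
      by (auto simp: y_def sin_diff cos_diff sin_b cos_b)
    then have "y = pi"
      using y sin_gt_zero[of y] by (cases "y = 0"; cases "y = pi") auto
    then show ?thesis by (simp add: y_def)
  qed
  then have "\<theta> (t + 1) = \<theta> t + 2 * pi" for t using shift[of t b] by simp
  moreover have "vel \<gamma> t = of_real (cmod (vel \<gamma> t)) * cis (\<theta> t)" for t
    by (simp add: vel \<theta>_def exp_eq_polar norm_mult)
  ultimately show ?thesis using mono cont_\<theta> by blast
qed

lemma cross_vel:
  assumes "\<And>t. vel \<gamma> t = of_real (cmod (vel \<gamma> t)) * cis (\<theta> t)"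
  shows "Im (cnj (vel \<gamma> s) * vel \<gamma> t) = cmod (vel \<gamma> s) * cmod (vel \<gamma> t) * sin (\<theta> t - \<theta> s)"
proof -
  have "cnj (vel \<gamma> s) * vel \<gamma> t
      = of_real (cmod (vel \<gamma> s) * cmod (vel \<gamma> t)) * (cnj (cis (\<theta> s)) * cis (\<theta> t))"
    by (subst assms[of s], subst assms[of t]) (simp add: mult_ac)
  also have "cnj (cis (\<theta> s)) * cis (\<theta> t) = cis (\<theta> t - \<theta> s)"
    by (simp add: cis_cnj cis_mult)
  finally show ?thesis by simp
qed

subsection \<open>Convexity\<close>

text \<open>Height over the tangent at \<open>t\<close> has a derivative with the sign of
  \<open>sin (\<theta> x - \<theta> t)\<close>: it rises from 0 up to the half turn \<open>m\<close>
  and then falls back to 0 at \<open>t + 1\<close>, so it is positive in between. Rotation number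
  one guarantees that there is only one rise and one fall.\<close>

lemma curve_left_of_tangent:
  assumes "\<gamma> s \<noteq> \<gamma> t"
  shows "Im (cnj (vel \<gamma> t) * (\<gamma> s - \<gamma> t)) > 0"
proof -
  obtain \<theta> where \<theta>: "continuous_on UNIV \<theta>" "strict_mono \<theta>" "\<And>t. \<theta> (t + 1) = \<theta> t + 2 * pi"
    and vel: "\<And>t. vel \<gamma> t = of_real (cmod (vel \<gamma> t)) * cis (\<theta> t)"
    using tangent_angle_exists by blast
  have "\<exists>m. t \<le> m \<and> m \<le> t + 1 \<and> \<theta> m = \<theta> t + pi"
    using \<theta> by (intro IVT') (auto intro: continuous_on_subset)
  then obtain m where m: "\<theta> m = \<theta> t + pi" and tm: "t \<le> m" "m \<le> t + 1" by blast
  \<comment> \<open>The representative of \<open>s\<close> in the period starting at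
    \<open>t\<close>, so that monotonicity on either side of \<open>m\<close> applies.\<close>
  define r where "r = t + frac (s - t)"
  have r_eq: "r = s + of_int (- \<lfloor>s - t\<rfloor>)" by (simp add: r_def frac_def)
  then have \<gamma>r: "\<gamma> r = \<gamma> s" using periodic_int by metis
  then have "r \<noteq> t" using assms by auto
  then have r: "t < r" "r < t + 1" using frac_ge_0[of "s - t"] frac_lt_1[of "s - t"]
    by (auto simp: r_def less_le)
  define h where "h x = Im (cnj (vel \<gamma> t) * \<gamma> x)" for x
  have dh: "(h has_real_derivative cmod (vel \<gamma> t) * cmod (vel \<gamma> x) * sin (\<theta> x - \<theta> t)) (at x)" for x
    unfolding h_def cross_vel[OF vel, symmetric] by (rule deriv_linear_curve)
  have cont: "continuous_on S h" for S
    unfolding h_def by (intro continuous_intros continuous_curve)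
  have "h r > h t"
  proof (cases "r \<le> m")
    case True
    show ?thesis
    proof (rule DERIV_pos_imp_increasing_open[OF r(1) _ cont])
      fix x assume x: "t < x" "x < r"
      then have "\<theta> t < \<theta> x" "\<theta> x < \<theta> m" using \<theta>(2) True by (auto simp: strict_mono_less)
      then have "sin (\<theta> x - \<theta> t) > 0" using m by (intro sin_gt_zero) auto
      then have "cmod (vel \<gamma> t) * cmod (vel \<gamma> x) * sin (\<theta> x - \<theta> t) > 0" by simp
      then show "\<exists>y. (h has_real_derivative y) (at x) \<and> y > 0" using dh by blast
    qed
  next
    case False
    have "h (t + 1) < h r"
    proof (rule DERIV_neg_imp_decreasing_open[OF r(2) _ cont])
      fix x assume x: "r < x" "x < t + 1"
      then have "\<theta> m < \<theta> x" "\<theta> x < \<theta> (t + 1)" using \<theta>(2) False by (auto simp: strict_mono_less)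
      then have "sin (\<theta> x - \<theta> t) < 0"
        using m \<theta>(3) sin_gt_zero[of "\<theta> x - \<theta> t - pi"] by (auto simp: sin_diff)
      then have "cmod (vel \<gamma> t) * cmod (vel \<gamma> x) * sin (\<theta> x - \<theta> t) < 0"
        by (simp add: mult_pos_neg)
      then show "\<exists>y. (h has_real_derivative y) (at x) \<and> y < 0" using dh by blast
    qed
    then show ?thesis by (simp add: h_def periodic)
  qed
  then show ?thesis by (simp add: h_def \<gamma>r algebra_simps)
qed

lemma curve_left_of_tangent_le: "Im (cnj (vel \<gamma> t) * (\<gamma> s - \<gamma> t)) \<ge> 0"
  using curve_left_of_tangent[of s t] by (cases "\<gamma> s = \<gamma> t") auto

text \<open>The closed half plane left of the tangent contains the curve and, being convex, also
  everything the curve encloses. Passing to interiors makes the inequality strict.\<close>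

lemma interior_left_of_tangent:
  assumes "p \<in> interior (oval_domain \<gamma>)"
  shows "Im (cnj (vel \<gamma> t) * (p - \<gamma> t)) > 0"
proof -
  define n where "n = \<i> * vel \<gamma> t"
  have n: "n \<bullet> q - n \<bullet> \<gamma> t = Im (cnj (vel \<gamma> t) * (q - \<gamma> t))" for q
    by (simp add: n_def inner_complex_def algebra_simps)
  have "n \<noteq> 0" by (simp add: n_def)
  define H where "H = {q. n \<bullet> q \<ge> n \<bullet> \<gamma> t}"
  have "range \<gamma> \<subseteq> H"
    using curve_left_of_tangent_le[of t] n by (auto simp: H_def) (metis diff_ge_0_iff_ge)
  moreover have "inside (range \<gamma>) \<subseteq> H"
    using inside_mono[OF \<open>range \<gamma> \<subseteq> H\<close>] inside_convex[of H]
    by (auto simp: H_def convex_halfspace_ge)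
  ultimately have "interior (oval_domain \<gamma>) \<subseteq> interior H"
    unfolding oval_domain_def by (intro interior_mono) auto
  then have "n \<bullet> p > n \<bullet> \<gamma> t"
    using assms interior_halfspace_ge[OF \<open>n \<noteq> 0\<close>] by (auto simp: H_def)
  then show ?thesis using n[of p] by simp
qed

lemma curve_bounded: "\<exists>M. \<forall>t. cmod (\<gamma> t - p) \<le> M"
proof -
  obtain b where "\<And>t. - cmod (\<gamma> b - p) \<le> - cmod (\<gamma> t - p)"
    by (rule attains_min[of "\<lambda>z. - cmod (z - p)"]) (auto intro!: continuous_intros)
  then show ?thesis by (metis neg_le_iff_le)
qed

text \<open>Compactness of one period makes the clearance uniform. This \<open>h\<close> later
  forces the axis crossing to infinity and keeps the rotation defect strictly positive.\<close>

lemma interior_distance_to_tangents: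
  assumes "p \<in> interior (oval_domain \<gamma>)"
  obtains h where "h > 0" "\<And>t. Im (cnj (vel \<gamma> t) * (p - \<gamma> t)) \<ge> h * cmod (vel \<gamma> t)"
proof -
  define f where "f t = Im (cnj (vel \<gamma> t) * (p - \<gamma> t)) / cmod (vel \<gamma> t)" for t
  have "continuous_on {0..1} f"
    unfolding f_def by (intro continuous_intros continuous_vel continuous_curve) auto
  then have "\<exists>b\<in>{0..1}. \<forall>t\<in>{0..1}. f b \<le> f t"
    by (intro continuous_attains_inf) auto
  then obtain b where b: "\<And>t. t \<in> {0..1} \<Longrightarrow> f b \<le> f t" by blast
  have "f b \<le> f t" for t
  proof -
    have "f (frac t) = f t"
      using periodic_int[of t "- \<lfloor>t\<rfloor>"] vel_periodic_int[of t "- \<lfloor>t\<rfloor>"]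
      by (simp add: f_def frac_def)
    then show ?thesis using b[of "frac t"] by (simp add: frac_lt_1 less_imp_le)
  qed
  then have "f b \<le> Im (cnj (vel \<gamma> t) * (p - \<gamma> t)) / cmod (vel \<gamma> t)" for t
    by (simp only: f_def[of t, symmetric])
  then have "f b * cmod (vel \<gamma> t) \<le> Im (cnj (vel \<gamma> t) * (p - \<gamma> t))" for t
    by (simp only: pos_le_divide_eq zero_less_norm_iff vel_nonzero not_False_eq_True)
  moreover have "f b > 0"
    using interior_left_of_tangent[OF assms] by (simp add: f_def)
  ultimately show ?thesis using that by blast
qed

subsection \<open>Tangency points\<close>

text \<open>Two different candidates would each lie left of the tangent at the other. Both
  differences are combinations of the same two velocities, so the determinant of these velocities
  would be positive in either order.\<close>

lemma x_plus_eqI: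
  assumes "c > 0" "\<gamma> t - A = of_real c * vel \<gamma> t"
  shows "x_plus \<gamma> A = \<gamma> t"
  unfolding x_plus_def
proof (rule the_equality)
  fix x assume "\<exists>s. x = \<gamma> s \<and> (\<exists>d>0. x - A = of_real d * vel \<gamma> s)"
  then obtain s d where s: "x = \<gamma> s" "d > 0" "\<gamma> s - A = of_real d * vel \<gamma> s" by blast
  show "x = \<gamma> t"
  proof (rule ccontr)
    assume "x \<noteq> \<gamma> t"
    have e: "\<gamma> s - \<gamma> t = of_real d * vel \<gamma> s - of_real c * vel \<gamma> t"
      unfolding s(3)[symmetric] assms(2)[symmetric] by simp
    have "d * Im (cnj (vel \<gamma> t) * vel \<gamma> s) > 0"
      using curve_left_of_tangent[of s t] \<open>x \<noteq> \<gamma> t\<close> s(1) unfolding e by (simp add: algebra_simps)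
    moreover have "c * Im (cnj (vel \<gamma> s) * vel \<gamma> t) > 0"
      using curve_left_of_tangent[of t s] \<open>x \<noteq> \<gamma> t\<close> s(1) e
      unfolding minus_diff_eq[of "\<gamma> s" "\<gamma> t", symmetric] by (simp add: algebra_simps)
    ultimately show False using assms(1) s(2)
      by (simp add: zero_less_mult_iff algebra_simps)
  qed
qed (use assms in auto)

lemma x_minus_eqI:
  assumes "c > 0" "A - \<gamma> t = of_real c * vel \<gamma> t"
  shows "x_minus \<gamma> A = \<gamma> t"
  unfolding x_minus_def
proof (rule the_equality)
  fix x assume "\<exists>s. x = \<gamma> s \<and> (\<exists>d>0. A - x = of_real d * vel \<gamma> s)"
  then obtain s d where s: "x = \<gamma> s" "d > 0" "A - \<gamma> s = of_real d * vel \<gamma> s" by blast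
  show "x = \<gamma> t"
  proof (rule ccontr)
    assume "x \<noteq> \<gamma> t"
    have e: "\<gamma> s - \<gamma> t = of_real c * vel \<gamma> t - of_real d * vel \<gamma> s"
      unfolding s(3)[symmetric] assms(2)[symmetric] by simp
    have "d * Im (cnj (vel \<gamma> t) * vel \<gamma> s) < 0"
      using curve_left_of_tangent[of s t] \<open>x \<noteq> \<gamma> t\<close> s(1) unfolding e by (simp add: algebra_simps)
    moreover have "c * Im (cnj (vel \<gamma> s) * vel \<gamma> t) < 0"
      using curve_left_of_tangent[of t s] \<open>x \<noteq> \<gamma> t\<close> s(1) e
      unfolding minus_diff_eq[of "\<gamma> s" "\<gamma> t", symmetric] by (simp add: algebra_simps)
    ultimately show False using assms(1) s(2)
      by (simp add: mult_less_0_iff algebra_simps)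
  qed
qed (use assms in auto)

end

subsection \<open>Common tangents of a curve and a circle\<close>

lemma Re_of_real_mult: "Re (of_real b * z) = b * Re z"
  and Im_of_real_mult: "Im (of_real b * z) = b * Im z"
  by simp_all

text \<open>Tangency becomes a condition on the distance from the centre to the line, independent of
  the point and direction chosen to describe the line.\<close>

lemma circle_tangent_line_iff:
  assumes "v \<noteq> 0"
  shows "circle_tangent_line c r {q + of_real s * v | s. True} \<longleftrightarrow>
    \<bar>Im (cnj v * (c - q))\<bar> = r * cmod v"
proof
  assume "circle_tangent_line c r {q + of_real s * v | s. True}"
  then obtain p v' where p: "v' \<noteq> 0" "{q + of_real s * v | s. True} = {p + of_real s * v' | s. True}"
    "cmod (p - c) = r" "Re (cnj (p - c) * v') = 0"
    unfolding circle_tangent_line_def by blast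
  \<comment> \<open>Two points of the second description, at parameters 0 and 1, exhibit its
    direction as a multiple of \<open>v\<close>.\<close>
  have "p + of_real 0 * v' \<in> {q + of_real s * v | s. True}" unfolding p(2) by blast
  then obtain s0 where s0: "p = q + of_real s0 * v" by auto
  have "p + of_real 1 * v' \<in> {q + of_real s * v | s. True}" unfolding p(2) by blast
  then obtain s1 where s1: "p + v' = q + of_real s1 * v" by auto
  note s = s0 s1
  from s have v': "v' = of_real (s1 - s0) * v" by (simp add: algebra_simps)
  have "(s1 - s0) * Re (cnj (p - c) * v) = 0"
    using p(4) unfolding v' by (simp add: algebra_simps)
  moreover have "s1 - s0 \<noteq> 0" using p(1) v' by auto
  ultimately have "Re (cnj (p - c) * v) = 0" by (metis mult_eq_0_iff)
  then have R0: "Re (cnj v * (c - p)) = 0" by (simp add: algebra_simps)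
  have "cmod (cnj v * (c - p)) = \<bar>Im (cnj v * (c - p))\<bar>"
    using R0 by (simp only: cmod_def) simp
  moreover have "Im (cnj v * (c - p)) = Im (cnj v * (c - q))"
    unfolding s(1) by (simp add: algebra_simps)
  ultimately show "\<bar>Im (cnj v * (c - q))\<bar> = r * cmod v"
    using p(3) by (simp add: norm_mult norm_minus_commute mult.commute)
next
  assume dist: "\<bar>Im (cnj v * (c - q))\<bar> = r * cmod v"
  \<comment> \<open>Parameter of the foot of the perpendicular from \<open>c\<close>, which is the
    point of contact.\<close>
  define s0 where "s0 = Re (cnj v * (c - q)) / (cmod v)\<^sup>2"
  define p where "p = q + of_real s0 * v"
  have "cnj v * (c - p) = cnj v * (c - q) - of_real (s0 * (cmod v)\<^sup>2)"
    by (simp add: p_def algebra_simps complex_norm_square[symmetric] del: of_real_power)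
  then have R0: "Re (cnj v * (c - p)) = 0" and I: "Im (cnj v * (c - p)) = Im (cnj v * (c - q))"
    using assms by (simp_all add: s0_def)
  have "cmod (cnj v * (c - p)) = \<bar>Im (cnj v * (c - p))\<bar>"
    using R0 by (simp only: cmod_def) simp
  then have "cmod (p - c) = r"
    using dist I assms by (simp add: norm_mult norm_minus_commute)
  moreover have "Re (cnj (p - c) * v) = 0" using R0 by (simp add: algebra_simps)
  moreover have "{q + of_real s * v | s. True} = {p + of_real s * v | s. True}"
  proof (intro set_eqI iffI)
    fix z assume "z \<in> {q + of_real s * v | s. True}"
    then obtain s where "z = q + of_real s * v" by blast
    then have "z = p + of_real (s - s0) * v" by (simp add: p_def algebra_simps)
    then show "z \<in> {p + of_real s * v | s. True}" by blast
  next
    fix z assume "z \<in> {p + of_real s * v | s. True}"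
    then obtain s where "z = p + of_real s * v" by blast
    then have "z = q + of_real (s + s0) * v" by (simp add: p_def algebra_simps)
    then show "z \<in> {q + of_real s * v | s. True}" by blast
  qed
  ultimately show "circle_tangent_line c r {q + of_real s * v | s. True}"
    unfolding circle_tangent_line_def using assms by blast
qed

text \<open>In the frame with origin at the touching point and first axis along \<open>e\<close>, the tangent lengths
  from the vertex to the two sides agree, which pins down the centre.\<close>
lemma inscribed_circle_iff:
  fixes A e f c :: complex and a b r \<rho> :: real
  assumes e: "cmod e = 1" and f: "cmod f = 1" and ab: "a > 0" "b > 0"
    and D: "Im (cnj f * e) > 0"
    and \<rho>: "\<rho> = a * (1 - Re (cnj f * e)) / Im (cnj f * e)"
    and xp: "xp = A + of_real a * e" and xm: "xm = A - of_real b * f"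
  shows "(r > 0 \<and> cmod (c - xp) = r \<and> Re (cnj (c - xp) * (xp - A)) = 0 \<and>
      (\<exists>s>0. cmod (c - (A + of_real s * (A - xm))) = r \<and>
        Re (cnj (c - (A + of_real s * (A - xm))) * (A - xm)) = 0))
    \<longleftrightarrow> r = \<rho> \<and> c = xp - \<i> * of_real \<rho> * e"
proof -
  have ee: "cnj e * e = 1" using e by (metis complex_norm_square mult.commute of_real_1 power_one)
  define g where "g = f * cnj e"
  define z where "z = (c - xp) * cnj e"
  have fg: "f = g * e" and cz: "c = xp + z * e"
    using ee by (simp_all add: g_def z_def mult.assoc)
  have g1: "cmod g = 1" using e f by (simp add: g_def norm_mult)
  then have gsq: "(Re g)\<^sup>2 + (Im g)\<^sup>2 = 1" by (simp add: cmod_power2[symmetric])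
  have cfe: "cnj f * e = cnj g" using ee by (simp add: g_def mult.commute)
  have Dg: "Im g < 0" and \<rho>g: "\<rho> = a * (1 - Re g) / (- Im g)" using D \<rho> by (simp_all add: cfe)
  have cond1: "cmod (c - xp) = cmod z" using e by (simp add: cz norm_mult)
  have "cnj (c - xp) * (xp - A) = (cnj e * e) * (cnj z * of_real a)"
    by (simp add: cz xp mult_ac)
  then have cond2: "Re (cnj (c - xp) * (xp - A)) = 0 \<longleftrightarrow> Re z = 0" using ab by (simp add: ee)
  define X where "X s = of_real a + z - of_real (s * b) * g" for s
  have X: "c - (A + of_real s * (A - xm)) = X s * e" for s
    by (simp add: cz xp xm fg X_def algebra_simps)
  have cond3: "cmod (c - (A + of_real s * (A - xm))) = cmod (X s)" for s
    unfolding X using e by (simp add: norm_mult)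
  have "cnj (X s * e) * (A - xm) = (cnj e * e) * (of_real b * (cnj (X s) * g))" for s
    by (simp add: xm fg mult_ac)
  then have "Re (cnj (X s * e) * (A - xm)) = b * Re (cnj (X s) * g)" for s
    by (simp only: ee mult_1_left Re_of_real_mult)
  then have cond4: "Re (cnj (c - (A + of_real s * (A - xm))) * (A - xm)) = 0 \<longleftrightarrow>
      Re (cnj (X s) * g) = 0" for s
    unfolding X using ab by (simp only: mult_eq_0_iff) simp
  have ReX: "Re (cnj (X s) * g) = a * Re g + Im z * Im g - s * b" if "Re z = 0" for s
  proof -
    have "Re (cnj (X s) * g) = a * Re g + Im z * Im g - s * b * ((Re g)\<^sup>2 + (Im g)\<^sup>2)"
      using that by (simp add: X_def algebra_simps power2_eq_square)
    then show ?thesis by (simp add: gsq)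
  qed
  have normX: "(cmod (X s))\<^sup>2 = a\<^sup>2 + (Im z)\<^sup>2 + (s * b)\<^sup>2 - 2 * (s * b) * (a * Re g + Im z * Im g)"
    if "Re z = 0" for s
  proof -
    have "(cmod (X s))\<^sup>2 = a\<^sup>2 + (Im z)\<^sup>2 + (s * b)\<^sup>2 * ((Re g)\<^sup>2 + (Im g)\<^sup>2)
        - 2 * (s * b) * (a * Re g + Im z * Im g)"
      unfolding cmod_power2 using that by (simp add: X_def algebra_simps power2_eq_square)
    then show ?thesis by (simp add: gsq)
  qed
  show ?thesis unfolding cond1 cond2 cond3 cond4
  proof (intro iffI conjI; (elim conjE exE)?)
    fix s assume r: "r > 0" "cmod z = r" "Re z = 0" and s: "s > 0" "cmod (X s) = r" "Re (cnj (X s) * g) = 0"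
    have s1: "a * Re g + Im z * Im g = s * b" using ReX[of s] r s by simp
    have zr: "(Im z)\<^sup>2 = r\<^sup>2" using r(2,3) cmod_power2[of z] by simp
    have "(s * b)\<^sup>2 = a\<^sup>2"
      using normX[OF r(3), of s] s(2) zr unfolding s1 by (simp add: power2_eq_square)
    then have sb: "s * b = a" using ab s(1) by (simp add: power2_eq_iff_nonneg)
    have "Im z * Im g = a * (1 - Re g)" using s1 sb by (simp add: algebra_simps)
    then have "Im z = a * (1 - Re g) / Im g" using Dg by (simp add: eq_divide_eq)
    then have Imz: "Im z = - \<rho>" by (simp add: \<rho>g)
    have "Re g \<le> 1" using g1 complex_Re_le_cmod[of g] by simp
    then have "\<rho> \<ge> 0" using Dg ab by (simp add: \<rho>g divide_nonneg_neg mult_nonneg_nonneg divide_nonpos_pos)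
    then show "r = \<rho>" using zr r(1) by (simp add: Imz power2_eq_iff_nonneg)
    have "z = - \<i> * of_real \<rho>" using r(3) Imz by (simp add: complex_eq_iff)
    then show "c = xp - \<i> * of_real \<rho> * e" by (simp add: cz)
  next
    assume r: "r = \<rho>" "c = xp - \<i> * of_real \<rho> * e"
    then have "z * e = (- \<i> * of_real \<rho>) * e" using cz by simp
    then have z: "z = - \<i> * of_real \<rho>" using e by (metis mult_right_cancel norm_zero zero_neq_one)
    have "Re g < 1"
    proof -
      have "(Im g)\<^sup>2 > 0" using Dg by simp
      then have "(Re g)\<^sup>2 < 1" using gsq by linarith
      then show ?thesis by (metis abs_less_iff abs_square_less_1)
    qed
    then have \<rho>pos: "\<rho> > 0"
      unfolding \<rho>g using Dg ab by (intro divide_pos_pos mult_pos_pos) auto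
    then show "r > 0" "cmod z = r" "Re z = 0" by (simp_all add: r(1) z norm_mult)
    have s1: "a * Re g + Im z * Im g = a" using Dg by (simp add: z \<rho>g field_simps)
    \<comment> \<open>Since \<open>A - xm\<close> has length \<open>b\<close>, the parameter
      \<open>a / b\<close> marks the point at distance \<open>a\<close> from \<open>A\<close>: both
      sides of the angle have equal tangent lengths.\<close>
    have "Re (cnj (X (a / b)) * g) = 0" using ReX[of "a / b"] s1 ab by (simp add: z)
    moreover have "(cmod (X (a / b)))\<^sup>2 = r\<^sup>2"
      using normX[of "a / b"] s1 ab r(1) by (simp add: z power2_eq_square)
    then have "cmod (X (a / b)) = r" using \<open>r > 0\<close> by (simp add: power2_eq_iff_nonneg)
    ultimately show "\<exists>s>0. cmod (X s) = r \<and> Re (cnj (X s) * g) = 0" using ab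
      by (intro exI[of _ "a / b"]) auto
  qed
qed

text \<open>Half-angle parametrisation: a tangent with direction \<open>(w1, w2)\<close> to the circle of radius \<open>r\<close>
  below the axis meets the axis at \<open>x\<close> with \<open>x / r = (1 + w1) / w2\<close>.\<close>
lemma half_angle:
  fixes w1 w2 r x :: real
  assumes "w1\<^sup>2 + w2\<^sup>2 = 1" "w2 \<noteq> 0" "r > 0" "x * w2 = r * (1 + w1)"
  shows "w1 * (x\<^sup>2 + r\<^sup>2) = x\<^sup>2 - r\<^sup>2" "w2 * (x\<^sup>2 + r\<^sup>2) = 2 * x * r"
proof -
  have "w2 * w2 = (1 - w1) * (1 + w1)" using assms(1) by (simp add: power2_eq_square algebra_simps)
  then have "w2 * (r * w2) = w2 * (x * (1 - w1))"
    using assms(4) by (metis mult.assoc mult.commute)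
  then have r: "r * w2 = x * (1 - w1)" using assms(2) by simp
  have "w1 * (x\<^sup>2 + r\<^sup>2) - (x\<^sup>2 - r\<^sup>2) = r * (r * (1 + w1)) - x * (x * (1 - w1))"
    by (simp add: power2_eq_square algebra_simps)
  also have "\<dots> = 0" unfolding assms(4)[symmetric] r[symmetric] by simp
  finally show "w1 * (x\<^sup>2 + r\<^sup>2) = x\<^sup>2 - r\<^sup>2" by simp
  have "w2 * (x\<^sup>2 + r\<^sup>2) = x * (x * w2) + r * (r * w2)"
    by (simp add: power2_eq_square algebra_simps)
  also have "\<dots> = 2 * x * r" unfolding assms(4) r by (simp add: algebra_simps)
  finally show "w2 * (x\<^sup>2 + r\<^sup>2) = 2 * x * r" .
qed

text \<open>Here \<open>x\<close>, \<open>y\<close> are the axis crossings of two tangents with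
  directions \<open>w\<close>, \<open>v\<close>, and \<open>k\<close>, \<open>l\<close> lead from
  the crossings along the tangents to their contact points with the curve, which lie above the axis.
  The two left conditions say that each contact point is left of the other tangent. By the
  half-angle formulas the determinant \<open>d\<close> of the directions has the sign of
  \<open>x - y\<close>, so in every case both terms of one of the two conditions have the wrong
  sign.\<close>

lemma outer_tangents_not_mutually_left:
  fixes w1 w2 v1 v2 r x y k l :: real
  assumes w: "w1\<^sup>2 + w2\<^sup>2 = 1" and v: "v1\<^sup>2 + v2\<^sup>2 = 1" and same: "w2 * v2 > 0"
    and k: "k * w2 > 0" and l: "l * v2 > 0" and r: "r > 0"
    and x: "x * w2 = r * (1 + w1)" and y: "y * v2 = r * (1 + v1)"
    and left1: "- v2 * (x - y) - k * (w1 * v2 - w2 * v1) > 0"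
    and left2: "- w2 * (y - x) - l * (v1 * w2 - v2 * w1) > 0"
  shows False
proof -
  define d where "d = w1 * v2 - w2 * v1"
  have nz: "w2 \<noteq> 0" "v2 \<noteq> 0" using same by auto
  have pos: "x\<^sup>2 + r\<^sup>2 > 0" "y\<^sup>2 + r\<^sup>2 > 0" using r by (auto intro: add_nonneg_pos)
  have "d * ((x\<^sup>2 + r\<^sup>2) * (y\<^sup>2 + r\<^sup>2)) =
      (w1 * (x\<^sup>2 + r\<^sup>2)) * (v2 * (y\<^sup>2 + r\<^sup>2)) - (w2 * (x\<^sup>2 + r\<^sup>2)) * (v1 * (y\<^sup>2 + r\<^sup>2))"
    by (simp add: d_def algebra_simps)
  also have "\<dots> = (x\<^sup>2 - r\<^sup>2) * (2 * y * r) - (2 * x * r) * (y\<^sup>2 - r\<^sup>2)"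
    using half_angle[OF w nz(1) r x] half_angle[OF v nz(2) r y] by simp
  also have "\<dots> = (x - y) * (2 * r * (x * y + r\<^sup>2))"
    by (simp add: power2_eq_square algebra_simps)
  finally have d: "d * ((x\<^sup>2 + r\<^sup>2) * (y\<^sup>2 + r\<^sup>2)) = (x - y) * (2 * r * (x * y + r\<^sup>2))" .
  \<comment> \<open>Each crossing lies on the side given by the vertical sign of its tangent, and
    the two signs agree.\<close>
  have "x * y \<ge> 0"
  proof -
    have "(x * y) * (w2 * v2) = (r * (1 + w1)) * (r * (1 + v1))"
      unfolding x[symmetric] y[symmetric] by (simp add: mult_ac)
    moreover have "1 + w1 \<ge> 0" "1 + v1 \<ge> 0"
      using w v abs_square_le_1[of w1] abs_square_le_1[of v1]
        zero_le_power2[of w2] zero_le_power2[of v2] by linarith+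
    ultimately have "(x * y) * (w2 * v2) \<ge> 0" using r by simp
    then show ?thesis using same by (meson mult_neg_pos not_less)
  qed
  then have "2 * r * (x * y + r\<^sup>2) > 0" using r by (auto intro!: mult_pos_pos add_nonneg_pos)
  then have sgn_d: "x \<ge> y \<Longrightarrow> d \<ge> 0" "x \<le> y \<Longrightarrow> d \<le> 0"
    using d pos by (metis diff_ge_0_iff_ge mult_nonneg_nonneg less_imp_le mult_pos_pos zero_le_mult_iff not_less,
      metis diff_le_0_iff_le mult_nonpos_nonneg less_imp_le mult_pos_pos mult_le_0_iff not_less)
  have l1: "- v2 * (x - y) - k * d > 0" and l2: "w2 * (x - y) + l * d > 0"
    using left1 left2 by (simp_all add: d_def algebra_simps)
  show False
  proof (cases "w2 > 0")
    case True
    then have "v2 > 0" "k > 0" "l > 0" using same k l by (auto simp: zero_less_mult_iff)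
    show False
    proof (cases "x \<ge> y")
      case True
      then have "v2 * (x - y) \<ge> 0" "k * d \<ge> 0" using \<open>v2 > 0\<close> \<open>k > 0\<close> sgn_d by auto
      then show False using l1 by simp
    next
      case False
      then have "w2 * (x - y) \<le> 0" "l * d \<le> 0" using \<open>w2 > 0\<close> \<open>l > 0\<close> sgn_d
        by (auto simp: mult_le_0_iff)
      then show False using l2 by simp
    qed
  next
    case False
    then have "w2 < 0" using nz by simp
    then have "v2 < 0" "k < 0" "l < 0" using same k l by (auto simp: zero_less_mult_iff)
    show False
    proof (cases "x \<ge> y")
      case True
      then have "w2 * (x - y) \<le> 0" "l * d \<le> 0" using \<open>w2 < 0\<close> \<open>l < 0\<close> sgn_d
        by (auto simp: mult_le_0_iff)
      then show False using l2 by simp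
    next
      case False
      then have "v2 * (x - y) \<ge> 0" "k * d \<ge> 0" using \<open>v2 < 0\<close> \<open>k < 0\<close> sgn_d
        by (auto simp: zero_le_mult_iff)
      then show False using l1 by simp
    qed
  qed
qed

context oval_curve
begin

section \<open>Existence of the tangency points\<close>

text \<open>At \<open>b\<close> the height over the line in direction \<open>u\<close> is minimal,
  so \<open>u\<close> is parallel to the velocity; any further point of the curve then fixes the
  sign of the factor.\<close>

lemma supporting_direction:
  assumes u: "u \<noteq> 0" and left: "\<And>t. Im (cnj u * (\<gamma> t - \<gamma> b)) \<ge> 0"
  shows "\<exists>c>0. u = of_real c * vel \<gamma> b"
proof -
  have "Im (cnj u * vel \<gamma> b) = 0"
    by (rule DERIV_local_min[OF deriv_linear_curve(2)[of "cnj u" b], of 1])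
       (use left in \<open>auto simp: algebra_simps\<close>)
  then have "cnj (vel \<gamma> b) * u = of_real (Re (cnj (vel \<gamma> b) * u))"
    by (simp add: complex_eq_iff algebra_simps)
  moreover define c where "c = Re (cnj (vel \<gamma> b) * u) / (cmod (vel \<gamma> b))\<^sup>2"
  ultimately have "cnj (vel \<gamma> b) * u = of_real c * of_real ((cmod (vel \<gamma> b))\<^sup>2)"
    by (simp flip: of_real_mult)
  also have "\<dots> = cnj (vel \<gamma> b) * (of_real c * vel \<gamma> b)"
    by (simp only: complex_norm_square mult_ac)
  finally have uc: "u = of_real c * vel \<gamma> b" by simp
  have "\<gamma> (b + 1/2) \<noteq> \<gamma> b" using curve_neq[of b "b + 1/2"] by simp
  then have "Im (cnj (vel \<gamma> b) * (\<gamma> (b + 1/2) - \<gamma> b)) > 0" by (rule curve_left_of_tangent)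
  moreover have "c * Im (cnj (vel \<gamma> b) * (\<gamma> (b + 1/2) - \<gamma> b)) \<ge> 0"
    using left[of "b + 1/2"] unfolding uc by (simp add: algebra_simps)
  ultimately have "c \<ge> 0" by (metis zero_le_mult_iff not_less)
  moreover have "c \<noteq> 0" using u uc by auto
  ultimately show ?thesis using uc by (metis less_le)
qed

text \<open>Seen from \<open>A\<close> with the axis pointing to \<open>p\<close>, the whole curve
  has positive abscissa, so the slope of the ray from \<open>A\<close> to a curve point is
  continuous and attains its extrema. The minimum has the curve on the left of its ray and gives
  \<open>x\<^sub>+\<close>; the maximum gives \<open>x\<^sub>-\<close>.\<close>

lemma tangency_points_exist:
  assumes M: "\<And>t. cmod (\<gamma> t - p) \<le> M" and A: "cmod (A - p) > M"
  shows "\<exists>t c. c > 0 \<and> \<gamma> t - A = of_real c * vel \<gamma> t"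
    and "\<exists>t c. c > 0 \<and> A - \<gamma> t = of_real c * vel \<gamma> t"
proof -
  define w where "w z = cnj (p - A) * (z - A)" for z
  have Re_w: "Re (w (\<gamma> t)) > 0" for t
  proof -
    have "w (\<gamma> t) = of_real ((cmod (p - A))\<^sup>2) + cnj (p - A) * (\<gamma> t - p)"
      by (simp only: complex_norm_square w_def) (simp add: algebra_simps)
    then have "Re (w (\<gamma> t)) = (cmod (p - A))\<^sup>2 + Re (cnj (p - A) * (\<gamma> t - p))"
      by (simp only: plus_complex.sel Re_complex_of_real)
    moreover have "\<bar>Re (cnj (p - A) * (\<gamma> t - p))\<bar> \<le> cmod (p - A) * cmod (\<gamma> t - p)"
      by (metis abs_Re_le_cmod complex_mod_cnj norm_mult)
    moreover have "cmod (p - A) * cmod (\<gamma> t - p) < (cmod (p - A))\<^sup>2"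
    proof -
      have "cmod (\<gamma> t - p) < cmod (p - A)"
        using M[of t] A by (simp add: norm_minus_commute)
      moreover from this have "cmod (p - A) > 0"
        using norm_ge_zero[of "\<gamma> t - p"] by linarith
      ultimately show ?thesis by (simp add: power2_eq_square)
    qed
    ultimately show ?thesis by linarith
  qed
  have pA: "p \<noteq> A" using Re_w[of 0] by (auto simp: w_def)
  have cross: "Im (cnj (w (\<gamma> s)) * w (\<gamma> t)) = (cmod (p - A))\<^sup>2 * Im (cnj (\<gamma> s - A) * (\<gamma> t - A))" for s t
  proof -
    have "cnj (w (\<gamma> s)) * w (\<gamma> t) = of_real ((cmod (p - A))\<^sup>2) * (cnj (\<gamma> s - A) * (\<gamma> t - A))"
      by (simp only: complex_norm_square w_def) (simp add: mult_ac)
    then show ?thesis by (simp only: Im_of_real_mult)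
  qed
  have cont: "continuous_on (range \<gamma>) (\<lambda>z. Im (w z) / Re (w z))"
    unfolding w_def 
    by (intro continuous_intros ballI) (metis Re_w w_def rangeE less_irrefl)
  have slope: "Im (w (\<gamma> b)) / Re (w (\<gamma> b)) \<le> Im (w (\<gamma> t)) / Re (w (\<gamma> t)) \<longleftrightarrow>
      Im (cnj (\<gamma> b - A) * (\<gamma> t - A)) \<ge> 0" for b t
  proof -
    have "Im (w (\<gamma> b)) / Re (w (\<gamma> b)) \<le> Im (w (\<gamma> t)) / Re (w (\<gamma> t)) \<longleftrightarrow>
        Im (cnj (w (\<gamma> b)) * w (\<gamma> t)) \<ge> 0"
      using Re_w[of b] Re_w[of t] by (simp add: frac_le_eq pos_divide_le_eq divide_simps algebra_simps)
    then show ?thesis unfolding cross using pA by (simp only: zero_le_mult_iff) auto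
  qed
  have ne: "\<gamma> t - A \<noteq> 0" for t using Re_w[of t] by (auto simp: w_def)
  obtain b where "\<And>t. Im (w (\<gamma> b)) / Re (w (\<gamma> b)) \<le> Im (w (\<gamma> t)) / Re (w (\<gamma> t))"
    using attains_min[OF cont] by blast
  then have "Im (cnj (\<gamma> b - A) * (\<gamma> t - \<gamma> b)) \<ge> 0" for t
    unfolding slope by (simp add: algebra_simps)
  from supporting_direction[OF ne this] show "\<exists>t c. c > 0 \<and> \<gamma> t - A = of_real c * vel \<gamma> t" by blast
  obtain b where "\<And>t. - (Im (w (\<gamma> b)) / Re (w (\<gamma> b))) \<le> - (Im (w (\<gamma> t)) / Re (w (\<gamma> t)))"
    using attains_min[OF continuous_on_minus[OF cont]] by blast
  then have "Im (cnj (\<gamma> t - A) * (\<gamma> b - A)) \<ge> 0" for t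
    unfolding neg_le_iff_le slope .
  then have "Im (cnj (A - \<gamma> b) * (\<gamma> t - \<gamma> b)) \<ge> 0" for t
    by (simp add: algebra_simps)
  moreover have "A - \<gamma> b \<noteq> 0" using ne[of b] by auto
  ultimately show "\<exists>t c. c > 0 \<and> A - \<gamma> t = of_real c * vel \<gamma> t"
    using supporting_direction by blast
qed

section \<open>Unit tangents, tangent lines and outer tangents\<close>

definition unit_tangent :: "real \<Rightarrow> complex" where
  "unit_tangent t = sgn (vel \<gamma> t)"

lemma norm_unit_tangent [simp]: "cmod (unit_tangent t) = 1"
  by (simp add: unit_tangent_def norm_sgn)

lemma vel_eq: "vel \<gamma> t = of_real (cmod (vel \<gamma> t)) * unit_tangent t"
  by (simp add: unit_tangent_def sgn_eq)

lemma cnj_unit_tangent: "cnj (unit_tangent t) * unit_tangent t = 1"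
  by (metis complex_norm_square mult.commute norm_unit_tangent of_real_1 power_one)

lemma unit_tangent_cong: "\<gamma> s = \<gamma> t \<Longrightarrow> unit_tangent s = unit_tangent t"
  by (simp add: unit_tangent_def vel_cong[of s t])

lemma cross_vel_unit: "Im (cnj (vel \<gamma> t) * z) = cmod (vel \<gamma> t) * Im (cnj (unit_tangent t) * z)"
proof -
  have "cnj (vel \<gamma> t) * z = of_real (cmod (vel \<gamma> t)) * (cnj (unit_tangent t) * z)"
    by (subst vel_eq) simp
  then show ?thesis by (simp only: Im_of_real_mult)
qed

lemma curve_left_of_unit_tangent:
  assumes "\<gamma> s \<noteq> \<gamma> t" shows "Im (cnj (unit_tangent t) * (\<gamma> s - \<gamma> t)) > 0"
  using curve_left_of_tangent[OF assms] unfolding cross_vel_unit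
  by (metis norm_ge_zero not_less mult_nonneg_nonpos)

definition tangent_line :: "real \<Rightarrow> complex set" where
  "tangent_line t = {\<gamma> t + of_real s * vel \<gamma> t | s. True}"

lemma tangent_line_cong: "\<gamma> s = \<gamma> t \<Longrightarrow> tangent_line s = tangent_line t"
  by (simp add: tangent_line_def vel_cong[of s t])

lemma tangent_line_eq: "tangent_line t = {z. Im (cnj (unit_tangent t) * (z - \<gamma> t)) = 0}"
proof (intro set_eqI iffI)
  fix z assume "z \<in> tangent_line t"
  then obtain s where "z = \<gamma> t + of_real s * vel \<gamma> t" by (auto simp: tangent_line_def)
  then have "Im (cnj (vel \<gamma> t) * (z - \<gamma> t)) = 0" by simp
  then show "z \<in> {z. Im (cnj (unit_tangent t) * (z - \<gamma> t)) = 0}"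
    unfolding cross_vel_unit by (simp only: mult_eq_0_iff norm_eq_zero vel_nonzero mem_Collect_eq) simp
next
  fix z assume "z \<in> {z. Im (cnj (unit_tangent t) * (z - \<gamma> t)) = 0}"
  moreover define q where "q = Re (cnj (unit_tangent t) * (z - \<gamma> t))"
  ultimately have "cnj (unit_tangent t) * (z - \<gamma> t) = of_real q"
    by (simp add: complex_eq_iff)
  then have "z - \<gamma> t = of_real q * unit_tangent t"
    using cnj_unit_tangent[of t] by (metis mult.assoc mult.commute mult_1)
  also have "\<dots> = of_real (q / cmod (vel \<gamma> t)) * vel \<gamma> t"
    by (subst (2) vel_eq) simp
  finally have "z = \<gamma> t + of_real (q / cmod (vel \<gamma> t)) * vel \<gamma> t"
    by (simp add: algebra_simps)
  then show "z \<in> tangent_line t" unfolding tangent_line_def by blast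
qed

lemma tangent_lines_neq:
  assumes "\<gamma> s \<noteq> \<gamma> t" shows "tangent_line s \<noteq> tangent_line t"
proof -
  have "\<gamma> s \<in> tangent_line s" by (simp add: tangent_line_eq)
  moreover have "\<gamma> s \<notin> tangent_line t"
    using curve_left_of_unit_tangent[OF assms] unfolding tangent_line_eq mem_Collect_eq
    by (metis less_irrefl)
  ultimately show ?thesis by metis
qed

lemma tangent_line_iff_circle:
  "circle_tangent_line c r (tangent_line t) \<longleftrightarrow> \<bar>Im (cnj (unit_tangent t) * (c - \<gamma> t))\<bar> = r"
proof -
  have "circle_tangent_line c r (tangent_line t) \<longleftrightarrow>
      cmod (vel \<gamma> t) * \<bar>Im (cnj (unit_tangent t) * (c - \<gamma> t))\<bar> = cmod (vel \<gamma> t) * r"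
    unfolding tangent_line_def circle_tangent_line_iff[OF vel_nonzero] cross_vel_unit abs_mult
    by (simp only: abs_norm_cancel mult.commute)
  then show ?thesis by (simp only: mult_cancel_left norm_eq_zero vel_nonzero) simp
qed

lemma line_through_eq_tangent_line:
  assumes "of_real c * vel \<gamma> t = A - \<gamma> t" "c \<noteq> 0"
  shows "line_through A (\<gamma> t) = tangent_line t"
proof (intro set_eqI iffI)
  fix z assume "z \<in> line_through A (\<gamma> t)"
  then obtain s where "z = A + of_real s * (\<gamma> t - A)" unfolding line_through_def by blast
  then have "z = \<gamma> t + (A - \<gamma> t) - of_real s * (A - \<gamma> t)" by (simp add: algebra_simps)
  then have "z = \<gamma> t + of_real (c - s * c) * vel \<gamma> t"
    unfolding assms(1)[symmetric] by (simp add: algebra_simps)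
  then show "z \<in> tangent_line t" unfolding tangent_line_def by blast
next
  fix z assume "z \<in> tangent_line t"
  then obtain s where "z = \<gamma> t + of_real s * vel \<gamma> t" unfolding tangent_line_def by blast
  moreover have "vel \<gamma> t = of_real (1 / c) * (A - \<gamma> t)" using assms by (simp flip: assms(1))
  ultimately have "z = A + of_real (1 - s / c) * (\<gamma> t - A)"
    using assms(2) by (simp add: field_simps)
  then show "z \<in> line_through A (\<gamma> t)" unfolding line_through_def by blast
qed

text \<open>The tangent at \<open>t\<close> has the curve and the disc of radius \<open>r\<close> touching it externally at \<open>\<gamma> t0\<close>
  both on its left.\<close>
definition outer_tangent :: "real \<Rightarrow> real \<Rightarrow> real \<Rightarrow> bool" where
  "outer_tangent t0 r t \<longleftrightarrow>
     Im (cnj (unit_tangent t) * (\<gamma> t0 - \<i> * of_real r * unit_tangent t0 - \<gamma> t)) = r"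

text \<open>Signed distance \<open>- r\<close> puts the disc on the right of the tangent, while the
  curve is on its left. The point \<open>\<gamma> t0\<close> belongs to both, so it lies on the
  tangent, and strict convexity leaves only the contact point itself.\<close>

lemma separating_tangent:
  assumes "r > 0" "Im (cnj (unit_tangent t) * (\<gamma> t0 - \<i> * of_real r * unit_tangent t0 - \<gamma> t)) = - r"
  shows "\<gamma> t = \<gamma> t0"
proof (rule ccontr)
  assume "\<gamma> t \<noteq> \<gamma> t0"
  then have "Im (cnj (unit_tangent t) * (\<gamma> t0 - \<gamma> t)) > 0"
    using curve_left_of_unit_tangent[of t0 t] by simp
  moreover have "Im (cnj (unit_tangent t) * (\<gamma> t0 - \<gamma> t)) =
      - r + r * Re (cnj (unit_tangent t) * unit_tangent t0)"
    using assms(2) by (simp add: algebra_simps)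
  moreover have "Re (cnj (unit_tangent t) * unit_tangent t0) \<le> 1"
    using complex_Re_le_cmod[of "cnj (unit_tangent t) * unit_tangent t0"] by (simp add: norm_mult)
  ultimately show False using assms(1)
    by (smt (verit) mult_left_le)
qed

text \<open>Brings an outer tangent into the form used by the half-angle lemmas: \<open>w\<close> is
  its direction in the frame at \<open>\<gamma> t0\<close>, \<open>x\<close> its crossing with the
  axis, and \<open>k\<close> leads from there to the contact point.\<close>

lemma outer_tangent_coordinates:
  assumes r: "r > 0" and outer: "outer_tangent t0 r t"
  defines "w \<equiv> unit_tangent t * cnj (unit_tangent t0)"
  obtains x k where "Im w \<noteq> 0" "k * Im w > 0" "x * Im w = r * (1 + Re w)"
    "\<gamma> t = \<gamma> t0 + of_real x * unit_tangent t0 + of_real k * unit_tangent t"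
proof -
  define e where "e = unit_tangent t0"
  define \<zeta> where "\<zeta> = (\<gamma> t - \<gamma> t0) * cnj e"
  have ee: "cnj e * e = 1" by (simp add: e_def cnj_unit_tangent)
  have \<zeta>: "\<gamma> t = \<gamma> t0 + \<zeta> * e" and w: "unit_tangent t = w * e"
    using ee by (simp_all add: \<zeta>_def w_def e_def mult.assoc)
  have "cnj (unit_tangent t) * (\<gamma> t0 - \<i> * of_real r * e - \<gamma> t) = (cnj e * e) * (cnj w * (- \<i> * of_real r - \<zeta>))"
    by (simp add: \<zeta> w algebra_simps)
  then have "Im (cnj w * (- \<i> * of_real r - \<zeta>)) = r"
    using outer unfolding outer_tangent_def e_def[symmetric] ee by simp
  then have eq: "Im w * Re \<zeta> - Re w * Im \<zeta> = r * (1 + Re w)"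
    by (simp add: algebra_simps)
  have "cmod w = 1" by (simp add: w_def norm_mult)
  then have wsq: "(Re w)\<^sup>2 + (Im w)\<^sup>2 = 1" by (simp add: cmod_power2[symmetric])
  have "\<gamma> t \<noteq> \<gamma> t0"
  proof
    assume "\<gamma> t = \<gamma> t0"
    then have "\<zeta> = 0" "w = 1"
      using unit_tangent_cong[of t t0] ee by (simp_all add: \<zeta>_def w_def e_def mult.commute)
    then show False using eq r by simp
  qed
  from curve_left_of_unit_tangent[OF this]
  have "Im ((cnj e * e) * \<zeta>) > 0" by (simp add: \<zeta> e_def[symmetric] mult_ac)
  then have \<zeta>pos: "Im \<zeta> > 0" by (simp add: ee)
  \<comment> \<open>A tangent parallel to the axis would make the height of the contact point
    \<open>- 2 * r\<close> or 0, although it is positive.\<close>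
  have nz: "Im w \<noteq> 0"
  proof
    assume "Im w = 0"
    then have "Re w = 1 \<or> Re w = -1" using wsq by (simp add: power2_eq_1_iff)
    then show False using eq \<zeta>pos r \<open>Im w = 0\<close> by auto
  qed
  define k where "k = Im \<zeta> / Im w"
  define x where "x = Re \<zeta> - k * Re w"
  have k: "k * Im w = Im \<zeta>" using nz by (simp add: k_def)
  have "x * Im w = Im w * Re \<zeta> - Re w * (k * Im w)" by (simp add: x_def algebra_simps)
  then have x: "x * Im w = r * (1 + Re w)" unfolding k eq .
  have "\<zeta> = of_real x + of_real k * w" using k by (simp add: complex_eq_iff x_def)
  then have "\<gamma> t = \<gamma> t0 + of_real x * e + of_real k * unit_tangent t"
    by (simp add: \<zeta> w algebra_simps)
  then show ?thesis using that[of k x] nz k x \<zeta>pos by (simp add: e_def)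
qed

lemma outer_tangent_unique:
  assumes r: "r > 0" and outer: "outer_tangent t0 r s" "outer_tangent t0 r t"
    and same: "Im (unit_tangent s * cnj (unit_tangent t0)) * Im (unit_tangent t * cnj (unit_tangent t0)) > 0"
  shows "\<gamma> s = \<gamma> t"
proof (rule ccontr)
  assume neq: "\<gamma> s \<noteq> \<gamma> t"
  define e where "e = unit_tangent t0"
  have ee: "cnj e * e = 1" by (simp add: e_def cnj_unit_tangent)
  define w where "w = unit_tangent s * cnj e"
  define v where "v = unit_tangent t * cnj e"
  have we: "unit_tangent s = w * e" and ve: "unit_tangent t = v * e"
    using ee by (simp_all add: w_def v_def mult.assoc)
  obtain x k where k: "k * Im w > 0" and x: "x * Im w = r * (1 + Re w)"
    and s: "\<gamma> s = \<gamma> t0 + of_real x * e + of_real k * unit_tangent s"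
    using outer_tangent_coordinates[OF r outer(1)] unfolding w_def e_def by metis
  obtain y l where l: "l * Im v > 0" and y: "y * Im v = r * (1 + Re v)"
    and t: "\<gamma> t = \<gamma> t0 + of_real y * e + of_real l * unit_tangent t"
    using outer_tangent_coordinates[OF r outer(2)] unfolding v_def e_def by metis
  have "cmod w = 1" "cmod v = 1" by (simp_all add: w_def v_def e_def norm_mult)
  then have sq: "(Re w)\<^sup>2 + (Im w)\<^sup>2 = 1" "(Re v)\<^sup>2 + (Im v)\<^sup>2 = 1"
    by (simp_all add: cmod_power2[symmetric])
  have diff: "\<gamma> s - \<gamma> t = (of_real (x - y) + of_real k * w - of_real l * v) * e"
    by (simp add: s t we ve algebra_simps)
  have "cnj (unit_tangent t) * (\<gamma> s - \<gamma> t) = (cnj e * e) * (cnj v * (of_real (x - y) + of_real k * w - of_real l * v))"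
    unfolding diff ve by (simp add: mult_ac)
  then have "Im (cnj v * (of_real (x - y) + of_real k * w - of_real l * v)) > 0"
    using curve_left_of_unit_tangent[OF neq] unfolding ee by simp
  then have left1: "- Im v * (x - y) - k * (Re w * Im v - Im w * Re v) > 0"
    by (simp add: algebra_simps)
  have "cnj (unit_tangent s) * (\<gamma> t - \<gamma> s) = (cnj e * e) * (cnj w * (of_real (y - x) + of_real l * v - of_real k * w))"
    unfolding minus_diff_eq[of "\<gamma> s" "\<gamma> t", symmetric] diff we by (simp add: algebra_simps)
  then have "Im (cnj w * (of_real (y - x) + of_real l * v - of_real k * w)) > 0"
    using curve_left_of_unit_tangent[OF neq[symmetric]] unfolding ee by simp
  then have left2: "- Im w * (y - x) - l * (Re v * Im w - Im v * Re w) > 0"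
    by (simp add: algebra_simps)
  show False
    by (rule outer_tangents_not_mutually_left[OF sq _ k l r x y left1 left2])
       (use same in \<open>simp add: w_def v_def e_def\<close>)
qed

text \<open>Intermediate value theorem for the signed distance \<open>H\<close> from the moving
  tangent to the centre: it is \<open>- r\<close> at \<open>t0\<close> and exceeds \<open>r\<close>
  at the antiparallel tangent \<open>m\<close>. Strictly between these parameters the direction
  points upwards.\<close>

lemma outer_tangent_exists:
  assumes r: "r > 0"
  shows "\<exists>t. outer_tangent t0 r t \<and> Im (unit_tangent t * cnj (unit_tangent t0)) > 0"
proof -
  obtain \<theta> where \<theta>: "continuous_on UNIV \<theta>" "strict_mono \<theta>" "\<And>t. \<theta> (t + 1) = \<theta> t + 2 * pi"
    and vel: "\<And>t. vel \<gamma> t = of_real (cmod (vel \<gamma> t)) * cis (\<theta> t)"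
    using tangent_angle_exists by blast
  have unit: "unit_tangent t = cis (\<theta> t)" for t
  proof -
    have "of_real (cmod (vel \<gamma> t)) * unit_tangent t = of_real (cmod (vel \<gamma> t)) * cis (\<theta> t)"
      using vel vel_eq by metis
    then show ?thesis by simp
  qed
  define H where "H t = Im (cnj (unit_tangent t) * (\<gamma> t0 - \<i> * of_real r * unit_tangent t0 - \<gamma> t))" for t
  have cont: "continuous_on S H" for S
    unfolding H_def unit_tangent_def sgn_eq
    by (intro continuous_intros continuous_vel continuous_curve) auto
  have "\<exists>m. t0 \<le> m \<and> m \<le> t0 + 1 \<and> \<theta> m = \<theta> t0 + pi"
    using \<theta> by (intro IVT') (auto intro: continuous_on_subset)
  then obtain m where m: "\<theta> m = \<theta> t0 + pi" and tm: "t0 \<le> m" "m \<le> t0 + 1" by blast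
  have "cis (\<theta> m) = - cis (\<theta> t0)" unfolding m by (simp add: cis_mult[symmetric])
  then have um: "unit_tangent m = - unit_tangent t0" by (simp add: unit)
  have "cnj (unit_tangent t0) * (\<gamma> t0 - \<i> * of_real r * unit_tangent t0 - \<gamma> t0)
      = - \<i> * of_real r * (cnj (unit_tangent t0) * unit_tangent t0)"
    by (simp add: algebra_simps)
  then have "H t0 = Im (- \<i> * of_real r * 1)" by (simp only: H_def cnj_unit_tangent)
  then have H0: "H t0 = - r" by simp
  have "cnj (unit_tangent m) * (\<gamma> t0 - \<i> * of_real r * unit_tangent t0 - \<gamma> m)
      = \<i> * of_real r * (cnj (unit_tangent t0) * unit_tangent t0) + cnj (unit_tangent m) * (\<gamma> t0 - \<gamma> m)"
    by (simp add: um algebra_simps)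
  then have "H m = Im (\<i> * of_real r) + Im (cnj (unit_tangent m) * (\<gamma> t0 - \<gamma> m))"
    unfolding H_def cnj_unit_tangent by (simp only: mult_1_right plus_complex.sel)
  moreover have "\<gamma> t0 \<noteq> \<gamma> m"
  proof
    assume "\<gamma> t0 = \<gamma> m"
    then have "unit_tangent t0 = - unit_tangent t0" using unit_tangent_cong um by metis
    then have "unit_tangent t0 = 0" by simp
    then show False using norm_unit_tangent[of t0] by simp
  qed
  ultimately have Hm: "H m > r"
    using curve_left_of_unit_tangent[of t0 m] by simp
  obtain t where t: "t0 \<le> t" "t \<le> m" "H t = r"
    using IVT'[of H t0 r m, OF _ _ tm(1) cont] H0 Hm r by auto
  then have "t0 < t" "t < m" using H0 Hm r by (auto simp: less_le)
  then have "\<theta> t0 < \<theta> t" "\<theta> t < \<theta> m" using \<theta>(2) by (auto simp: strict_mono_less)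
  then have "sin (\<theta> t - \<theta> t0) > 0" using m by (intro sin_gt_zero) auto
  moreover have "unit_tangent t * cnj (unit_tangent t0) = cis (\<theta> t - \<theta> t0)"
    by (simp add: unit cis_cnj cis_mult)
  ultimately have "Im (unit_tangent t * cnj (unit_tangent t0)) > 0" by simp
  then show ?thesis using t(3) unfolding H_def outer_tangent_def by blast
qed

text \<open>The third common tangent is the unique outer tangent crossing the line \<open>A x\<^sub>+\<close> upwards;
  the one crossing it downwards is \<open>A x\<^sub>-\<close>.\<close>
lemma outer_length_billiard_eq:
  assumes tp: "a > 0" "\<gamma> tp - A = of_real a * unit_tangent tp"
    and tm: "b > 0" "A - \<gamma> tm = of_real b * unit_tangent tm"
    and r: "r = a * (1 - Re (cnj (unit_tangent tm) * unit_tangent tp)) / Im (cnj (unit_tangent tm) * unit_tangent tp)"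
  obtains x t where "r > 0" "x > 0" "outer_length_billiard \<gamma> A = \<gamma> tp + of_real x * unit_tangent tp"
    "\<gamma> t - (\<gamma> tp + of_real x * unit_tangent tp) \<in> range (\<lambda>k. of_real k * unit_tangent t)"
    "Im (unit_tangent t * cnj (unit_tangent tp)) > 0"
    "x * Im (unit_tangent t * cnj (unit_tangent tp)) = r * (1 + Re (unit_tangent t * cnj (unit_tangent tp)))"
proof -
  define e f where "e = unit_tangent tp" and "f = unit_tangent tm"
  have ee: "cnj e * e = 1" and ff: "cnj f * f = 1" by (simp_all add: e_def f_def cnj_unit_tangent)
  have e1: "cmod e = 1" and f1: "cmod f = 1" by (simp_all add: e_def f_def)
  have xp: "\<gamma> tp = A + of_real a * e" and xm: "\<gamma> tm = A - of_real b * f"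
    using tp(2) tm(2) by (simp_all add: e_def f_def algebra_simps)
  have unit_vel: "of_real c * unit_tangent t = of_real (c / cmod (vel \<gamma> t)) * vel \<gamma> t" for c t
    by (subst (2) vel_eq) simp
  have x_plus: "x_plus \<gamma> A = \<gamma> tp"
    by (rule x_plus_eqI[of "a / cmod (vel \<gamma> tp)"]) (use tp in \<open>auto simp: unit_vel\<close>)
  have x_minus: "x_minus \<gamma> A = \<gamma> tm"
    by (rule x_minus_eqI[of "b / cmod (vel \<gamma> tm)"]) (use tm in \<open>auto simp: unit_vel\<close>)
  have line_p: "line_through A (\<gamma> tp) = tangent_line tp"
    by (rule line_through_eq_tangent_line[of "- a / cmod (vel \<gamma> tp)"])
       (use tp unit_vel[of a tp] in \<open>auto simp: algebra_simps\<close>)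
  have line_m: "line_through A (\<gamma> tm) = tangent_line tm"
    by (rule line_through_eq_tangent_line[of "b / cmod (vel \<gamma> tm)"])
       (use tm unit_vel[of b tm] in auto)
  have ne: "\<gamma> tm \<noteq> \<gamma> tp"
  proof
    assume "\<gamma> tm = \<gamma> tp"
    then have "e = f" using unit_tangent_cong[of tm tp] by (simp add: e_def f_def)
    then have "of_real (a + b) * e = 0" using xp xm \<open>\<gamma> tm = \<gamma> tp\<close> by (simp add: algebra_simps)
    then show False using e1 tp(1) tm(1) by (auto simp: of_real_add[symmetric] simp del: of_real_add)
  qed
  \<comment> \<open>The height of \<open>\<gamma> tm\<close> over the tangent at
    \<open>\<gamma> tp\<close> equals \<open>b\<close> times this determinant, and strict convexity
    makes it positive.\<close>
  have D: "Im (cnj f * e) > 0"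
  proof -
    have "cnj e * (\<gamma> tm - \<gamma> tp) = - of_real b * (cnj e * f) - of_real a * (cnj e * e)"
      by (simp add: xp xm algebra_simps)
    then have "cnj e * (\<gamma> tm - \<gamma> tp) = - of_real b * (cnj e * f) - of_real a" unfolding ee by simp
    then have "Im (cnj e * (\<gamma> tm - \<gamma> tp)) = b * Im (cnj f * e)"
      by (simp only: minus_complex.sel Im_of_real_mult Im_complex_of_real of_real_minus[symmetric])
         (simp add: algebra_simps)
    then have "b * Im (cnj f * e) > 0" using curve_left_of_unit_tangent[OF ne] by (simp add: e_def)
    then show ?thesis using tm(1) by (simp only: zero_less_mult_iff) auto
  qed
  have rr: "r = a * (1 - Re (cnj f * e)) / Im (cnj f * e)" using r by (simp add: e_def f_def)
  note circ = inscribed_circle_iff[OF e1 f1 tp(1) tm(1) D rr xp xm]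
  have sigma: "sigma_circle \<gamma> A c r' \<longleftrightarrow> r' = r \<and> c = \<gamma> tp - \<i> * of_real r * e" for c r'
    unfolding sigma_circle_def Let_def x_plus x_minus circ ..
  define c where "c = \<gamma> tp - \<i> * of_real r * e"
  have rpos: "r > 0" using circ[of r c] by (simp add: c_def)
  have outer_c: "outer_tangent tp r t \<longleftrightarrow> Im (cnj (unit_tangent t) * (c - \<gamma> t)) = r" for t
    by (simp add: outer_tangent_def c_def e_def)
  have fe: "Im (f * cnj e) < 0" using D by (simp add: algebra_simps)
  \<comment> \<open>The formula for \<open>r\<close> is the tangent of a half angle written as (1 -
    cos) / sin; tangency to the second side is the equivalent form with sin / (1 + cos).\<close>
  have outer_m: "outer_tangent tp r tm"
  proof -
    define g where "g = cnj f * e"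
    have "cmod g = 1" by (simp add: g_def norm_mult e1 f1)
    then have gsq: "(Re g)\<^sup>2 + (Im g)\<^sup>2 = 1" by (simp add: cmod_power2[symmetric])
    have "Im g > 0" using D by (simp add: g_def)
    have rg: "r * Im g = a * (1 - Re g)" using rr D by (simp add: g_def[symmetric])
    have "cnj f * (c - \<gamma> tm) = of_real a * g - \<i> * of_real r * g + of_real b * (cnj f * f)"
      by (simp add: c_def xp xm g_def algebra_simps)
    then have "Im (cnj f * (c - \<gamma> tm)) = a * Im g - r * Re g" unfolding ff by simp
    moreover have "a * Im g - r * Re g = r"
    proof -
      have "Im g * (a * Im g) = Im g * (r * (1 + Re g))"
      proof -
        have "Im g * (r * (1 + Re g)) = a * ((1 - Re g) * (1 + Re g))"
          using rg by (metis mult.assoc mult.commute)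
        also have "(1 - Re g) * (1 + Re g) = Im g * Im g"
          using gsq by (simp add: power2_eq_square algebra_simps)
        finally show ?thesis by (simp only: mult_ac)
      qed
      then have "a * Im g = r * (1 + Re g)" using \<open>Im g > 0\<close> by simp
      then show ?thesis by (simp add: algebra_simps)
    qed
    ultimately show ?thesis unfolding outer_c f_def by simp
  qed
  obtain t1 where t1: "outer_tangent tp r t1" and up: "Im (unit_tangent t1 * cnj e) > 0"
    using outer_tangent_exists[OF rpos] unfolding e_def by blast
  obtain x k where x: "x * Im (unit_tangent t1 * cnj e) = r * (1 + Re (unit_tangent t1 * cnj e))"
    and \<gamma>1: "\<gamma> t1 = \<gamma> tp + of_real x * e + of_real k * unit_tangent t1"
    using outer_tangent_coordinates[OF rpos t1] unfolding e_def by metis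
  define w where "w = unit_tangent t1 * cnj e"
  have "cmod w = 1" by (simp add: w_def norm_mult e1)
  then have wsq: "(Re w)\<^sup>2 + (Im w)\<^sup>2 = 1" by (simp add: cmod_power2[symmetric])
  have "Im w > 0" using up by (simp add: w_def)
  have "x > 0"
  proof -
    have "(Im w)\<^sup>2 > 0" using \<open>Im w > 0\<close> by simp
    then have "(Re w)\<^sup>2 < 1" using wsq by linarith
    then have "1 + Re w > 0" using abs_square_less_1[of "Re w"] by linarith
    then have "x * Im w > 0" using x rpos by (simp add: w_def[symmetric])
    then show ?thesis using \<open>Im w > 0\<close> by (simp add: zero_less_mult_iff)
  qed
  have ne_p: "\<gamma> t1 \<noteq> \<gamma> tp"
  proof
    assume "\<gamma> t1 = \<gamma> tp"
    then have "unit_tangent t1 = e" using unit_tangent_cong[of t1 tp] by (simp add: e_def)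
    then show False using up ee by (simp add: mult.commute)
  qed
  have ne_m: "\<gamma> t1 \<noteq> \<gamma> tm"
  proof
    assume "\<gamma> t1 = \<gamma> tm"
    then have "unit_tangent t1 = f" using unit_tangent_cong[of t1 tm] by (simp add: f_def)
    then show False using up fe by (simp only:)
  qed
  define B where "B = \<gamma> tp + of_real x * e"
  have B_p: "B \<in> tangent_line tp"
  proof -
    have "cnj e * (B - \<gamma> tp) = of_real x * (cnj e * e)" by (simp add: B_def)
    then have "Im (cnj e * (B - \<gamma> tp)) = 0" by (simp only: ee mult_1_right Im_complex_of_real)
    then show ?thesis by (simp only: tangent_line_eq e_def mem_Collect_eq)
  qed
  have B_1: "B \<in> tangent_line t1"
  proof -
    have "cnj (unit_tangent t1) * (B - \<gamma> t1) = - of_real k * (cnj (unit_tangent t1) * unit_tangent t1)"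
      unfolding B_def by (subst \<gamma>1) (simp add: algebra_simps)
    then have "Im (cnj (unit_tangent t1) * (B - \<gamma> t1)) = 0"
      by (simp only: cnj_unit_tangent mult_1_right uminus_complex.sel Im_complex_of_real minus_zero)
    then show ?thesis by (simp only: tangent_line_eq mem_Collect_eq)
  qed
  have "outer_length_billiard \<gamma> A = B"
    unfolding outer_length_billiard_def x_plus x_minus line_p line_m sigma c_def[symmetric]
  proof (rule the_equality)
    have "circle_tangent_line c r (tangent_line t1)"
      unfolding tangent_line_iff_circle using t1 rpos by (simp only: outer_c)
    moreover have "curve_tangent_line \<gamma> (tangent_line t1)"
      unfolding curve_tangent_line_def tangent_line_def by blast
    ultimately show "\<exists>c' r' L. (r' = r \<and> c' = c) \<and> circle_tangent_line c' r' L \<and>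
        curve_tangent_line \<gamma> L \<and> L \<noteq> tangent_line tp \<and> L \<noteq> tangent_line tm \<and>
        B \<in> L \<and> B \<in> tangent_line tp"
      using tangent_lines_neq[OF ne_p] tangent_lines_neq[OF ne_m] B_p B_1 by blast
  next
    fix B' assume "\<exists>c' r' L. (r' = r \<and> c' = c) \<and> circle_tangent_line c' r' L \<and>
        curve_tangent_line \<gamma> L \<and> L \<noteq> tangent_line tp \<and> L \<noteq> tangent_line tm \<and>
        B' \<in> L \<and> B' \<in> tangent_line tp"
    then obtain t where t: "circle_tangent_line c r (tangent_line t)"
      "tangent_line t \<noteq> tangent_line tp" "tangent_line t \<noteq> tangent_line tm"
      "B' \<in> tangent_line t" "B' \<in> tangent_line tp"
      unfolding curve_tangent_line_def tangent_line_def by blast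
    \<comment> \<open>Of the two signs permitted by tangency, the negative one belongs only to the
      tangent at \<open>x\<^sub>+\<close>, which is excluded.\<close>
    have "Im (cnj (unit_tangent t) * (c - \<gamma> t)) \<noteq> - r"
      using separating_tangent[OF rpos, of t tp] tangent_line_cong[of t tp] t(2)
      by (auto simp: c_def e_def)
    then have outer: "outer_tangent tp r t"
      using t(1) unfolding tangent_line_iff_circle outer_c by linarith
    have nz: "Im (unit_tangent t * cnj e) \<noteq> 0"
      using outer_tangent_coordinates[OF rpos outer] unfolding e_def by metis
    have "\<not> Im (unit_tangent t * cnj e) < 0"
    proof
      assume "Im (unit_tangent t * cnj e) < 0"
      then have "Im (unit_tangent t * cnj e) * Im (f * cnj e) > 0" using fe by (rule mult_neg_neg)
      then have "\<gamma> t = \<gamma> tm"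
        using outer_tangent_unique[OF rpos outer outer_m] by (simp add: e_def f_def)
      then show False using t(3) tangent_line_cong by blast
    qed
    then have "Im (unit_tangent t * cnj e) > 0" using nz by linarith
    then have "Im (unit_tangent t * cnj e) * Im (unit_tangent t1 * cnj e) > 0"
      using up by (rule mult_pos_pos)
    then have "\<gamma> t = \<gamma> t1"
      using outer_tangent_unique[OF rpos outer t1] by (simp add: e_def)
    then have B': "B' \<in> tangent_line t1" using t(4) tangent_line_cong by blast
    \<comment> \<open>Uniqueness of the intersection: \<open>B'\<close> and \<open>B\<close> differ
      by a multiple of \<open>e\<close>, while the direction of the third tangent has a nonzero
      component across \<open>e\<close>.\<close>
    define q where "q = Re (cnj e * (B' - \<gamma> tp))"
    have "cnj e * (B' - \<gamma> tp) = of_real q"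
      using t(5) by (simp add: tangent_line_eq e_def q_def complex_eq_iff)
    then have "B' - \<gamma> tp = of_real q * e" using ee by (metis mult.assoc mult.commute mult_1)
    then have BB: "B' - B = of_real (q - x) * e" by (simp add: B_def algebra_simps)
    have "Im (cnj (unit_tangent t1) * (B' - B)) = 0"
    proof -
      have "cnj (unit_tangent t1) * (B' - B) = cnj (unit_tangent t1) * (B' - \<gamma> t1)
          - cnj (unit_tangent t1) * (B - \<gamma> t1)" by (simp add: algebra_simps)
      then show ?thesis using B' B_1 unfolding tangent_line_eq mem_Collect_eq
        by (simp only: minus_complex.sel diff_self)
    qed
    moreover have "cnj (unit_tangent t1) * (B' - B) = of_real (q - x) * cnj (unit_tangent t1 * cnj e)"
      unfolding BB by (simp add: mult_ac)
    ultimately have "(q - x) * Im (unit_tangent t1 * cnj e) = 0"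
      by (simp only: Im_of_real_mult cnj.sel mult_minus_right neg_equal_0_iff_equal)
    then have "q = x" using up by (simp only: mult_eq_0_iff) auto
    then show "B' = B" using BB by simp
  qed
  moreover have "\<gamma> t1 - B = of_real k * unit_tangent t1" unfolding B_def by (subst \<gamma>1) simp
  then have "\<gamma> t1 - B \<in> range (\<lambda>k. of_real k * unit_tangent t1)" by (rule range_eqI)
  ultimately show ?thesis
    unfolding B_def e_def by (rule that[OF rpos \<open>x > 0\<close> _ _ up[unfolded e_def] x[unfolded e_def]])
qed

text \<open>The last conclusion says that \<open>p\<close> lies on the left of the third tangent.\<close>
lemma billiard_step:
  assumes M: "\<And>t. cmod (\<gamma> t - p) \<le> M"
    and h: "\<And>t. Im (cnj (vel \<gamma> t) * (p - \<gamma> t)) \<ge> h * cmod (vel \<gamma> t)" "h > 0"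
    and A: "cmod (A - p) > 3 * M"
  obtains q e a r x where "cmod e = 1" "cmod (q - p) \<le> M" "Im (cnj e * (p - q)) \<ge> h"
    "a \<ge> cmod (A - p) - M" "x > 0" "r \<ge> a" "A = q - of_real a * e"
    "outer_length_billiard \<gamma> A = q + of_real x * e"
    "(r\<^sup>2 - x\<^sup>2) * Im (cnj e * (p - q)) \<le> 2 * x * r * (x - Re (cnj e * (p - q)))"
proof -
  have hu: "Im (cnj (unit_tangent t) * (p - \<gamma> t)) \<ge> h" for t
    using h(1)[of t] unfolding cross_vel_unit by (simp only: mult.commute[of h] mult_le_cancel_left) auto
  have "M \<ge> 0" using M[of 0] norm_ge_zero order_trans by blast
  then have "cmod (A - p) > M" using A by linarith
  from tangency_points_exist[of p M, OF M this] obtain tp c tm d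
    where c: "c > 0" "\<gamma> tp - A = of_real c * vel \<gamma> tp" and d: "d > 0" "A - \<gamma> tm = of_real d * vel \<gamma> tm"
    by blast
  define e f where "e = unit_tangent tp" and "f = unit_tangent tm"
  define a b where "a = c * cmod (vel \<gamma> tp)" and "b = d * cmod (vel \<gamma> tm)"
  have a: "a > 0" "\<gamma> tp - A = of_real a * e" and b: "b > 0" "A - \<gamma> tm = of_real b * f"
    using c d vel_eq[of tp] vel_eq[of tm] by (simp_all add: a_def b_def e_def f_def)
  define r where "r = a * (1 - Re (cnj f * e)) / Im (cnj f * e)"
  obtain x t where rx: "r > 0" "x > 0" "outer_length_billiard \<gamma> A = \<gamma> tp + of_real x * e"
    "\<gamma> t - (\<gamma> tp + of_real x * e) \<in> range (\<lambda>k. of_real k * unit_tangent t)"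
    "Im (unit_tangent t * cnj e) > 0"
    "x * Im (unit_tangent t * cnj e) = r * (1 + Re (unit_tangent t * cnj e))"
    using outer_length_billiard_eq[OF a(1) a(2)[unfolded e_def] b(1) b(2)[unfolded f_def] r_def[unfolded e_def f_def]]
    unfolding e_def by metis
  have e1: "cmod e = 1" and f1: "cmod f = 1" by (simp_all add: e_def f_def)
  have "cmod (\<gamma> tp - A) = a" using a e1 by (simp add: norm_mult)
  then have a_ge: "a \<ge> cmod (A - p) - M"
    using M[of tp] norm_triangle_ineq[of "A - \<gamma> tp" "\<gamma> tp - p"] by (simp add: norm_minus_commute)
  \<comment> \<open>Law of cosines in the triangle \<open>A\<close>, \<open>x\<^sub>+\<close>,
    \<open>x\<^sub>-\<close>: the side opposite \<open>A\<close> is at most \<open>2 * M\<close>,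
    which is less than \<open>a\<close> because \<open>A\<close> is farther than
    \<open>3 * M\<close> away. So the angle at \<open>A\<close> is acute, the angle containing the
    circle is obtuse, and the tangent of half of it is at least 1.\<close>
  have r_ge: "r \<ge> a"
  proof -
    define g where "g = cnj f * e"
    have "cmod g = 1" by (simp add: g_def norm_mult e1 f1)
    then have gsq: "(Re g)\<^sup>2 + (Im g)\<^sup>2 = 1" by (simp add: cmod_power2[symmetric])
    have "Re g < 0"
    proof -
      have "(cmod (of_real a * g + of_real b))\<^sup>2 = a\<^sup>2 * ((Re g)\<^sup>2 + (Im g)\<^sup>2) + b\<^sup>2 + 2 * a * b * Re g"
        unfolding cmod_power2 by (simp add: power2_eq_square algebra_simps)
      moreover have "of_real a * g + of_real b = cnj f * (\<gamma> tp - \<gamma> tm)"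
      proof -
        have "\<gamma> tp - \<gamma> tm = of_real a * e + of_real b * f" using a(2) b(2) by (simp add: algebra_simps)
        then have "cnj f * (\<gamma> tp - \<gamma> tm) = of_real a * g + of_real b * (cnj f * f)"
          by (simp add: g_def algebra_simps)
        then show ?thesis by (simp add: f_def cnj_unit_tangent)
      qed
      moreover have "cmod (cnj f * (\<gamma> tp - \<gamma> tm)) \<le> 2 * M"
        using norm_triangle_ineq4[of "\<gamma> tp - p" "\<gamma> tm - p"] M[of tp] M[of tm] f1
        by (simp add: norm_mult)
      moreover have "2 * M < a" using a_ge A by linarith
      moreover from this have "(2 * M)\<^sup>2 < a\<^sup>2"
        using \<open>M \<ge> 0\<close> by (intro power_strict_mono) auto
      moreover have "(cmod (cnj f * (\<gamma> tp - \<gamma> tm)))\<^sup>2 \<le> (2 * M)\<^sup>2"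
        using calculation(3) by (intro power_mono) auto
      ultimately have "a\<^sup>2 + b\<^sup>2 + 2 * a * b * Re g < a\<^sup>2" using gsq by simp
      then have "2 * a * b * Re g < 0" using zero_le_power2[of b] by linarith
      then show ?thesis using a b by (simp add: mult_less_0_iff)
    qed
    moreover have "Im g \<le> 1" using \<open>cmod g = 1\<close> abs_Im_le_cmod[of g] by linarith
    moreover have "r = a * (1 - Re g) / Im g" by (simp add: r_def g_def)
    moreover have "Im g > 0"
    proof (rule ccontr)
      assume "\<not> Im g > 0"
      then have "r \<le> 0" using \<open>r = a * (1 - Re g) / Im g\<close> \<open>Re g < 0\<close> a(1)
        by (simp add: divide_nonneg_nonpos)
      then show False using rx(1) by simp
    qed
    ultimately show ?thesis using a(1) by (simp add: le_divide_eq)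
  qed
  have left: "(r\<^sup>2 - x\<^sup>2) * Im (cnj e * (p - \<gamma> tp)) \<le> 2 * x * r * (x - Re (cnj e * (p - \<gamma> tp)))"
  proof -
    define w where "w = unit_tangent t * cnj e"
    define \<omega> where "\<omega> = cnj e * (p - \<gamma> tp)"
    have ee: "cnj e * e = 1" by (simp add: e_def cnj_unit_tangent)
    have we: "unit_tangent t = w * e" using ee by (simp add: w_def mult.assoc)
    have "cmod w = 1" by (simp add: w_def norm_mult e1)
    then have wsq: "(Re w)\<^sup>2 + (Im w)\<^sup>2 = 1" by (simp add: cmod_power2[symmetric])
    have w2: "Im w > 0" and xw: "x * Im w = r * (1 + Re w)" using rx(5,6) by (simp_all only: w_def)
    from rx(4) obtain k where "\<gamma> t - (\<gamma> tp + of_real x * e) = of_real k * unit_tangent t" by blast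
    then have k: "\<gamma> t = \<gamma> tp + of_real x * e + of_real k * unit_tangent t"
      by (simp add: algebra_simps)
    have "cnj (unit_tangent t) * (p - \<gamma> t) =
        cnj w * (cnj e * (p - \<gamma> tp)) - of_real x * (cnj e * e) * cnj w
        - of_real k * (cnj (unit_tangent t) * unit_tangent t)"
      by (subst k) (simp add: we algebra_simps)
    then have "cnj (unit_tangent t) * (p - \<gamma> t) = cnj w * \<omega> - of_real x * cnj w - of_real k"
      unfolding ee cnj_unit_tangent \<omega>_def by simp
    then have "Im (cnj w * \<omega> - of_real x * cnj w - of_real k) \<ge> 0"
      using hu[of t] h(2) by (simp only:)
    then have "Re w * Im \<omega> - Im w * Re \<omega> + x * Im w \<ge> 0" by (simp add: algebra_simps)
    \<comment> \<open>Multiplying by this positive factor lets \<open>half_angle\<close> eliminate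
      the direction \<open>w\<close> in favour of \<open>x\<close> and \<open>r\<close>.\<close>
    then have "(x\<^sup>2 + r\<^sup>2) * (Re w * Im \<omega> - Im w * Re \<omega> + x * Im w) \<ge> 0"
      by (intro mult_nonneg_nonneg) auto
    also have "(x\<^sup>2 + r\<^sup>2) * (Re w * Im \<omega> - Im w * Re \<omega> + x * Im w) =
        (Re w * (x\<^sup>2 + r\<^sup>2)) * Im \<omega> + (Im w * (x\<^sup>2 + r\<^sup>2)) * (x - Re \<omega>)"
      by (simp add: algebra_simps)
    also have "\<dots> = (x\<^sup>2 - r\<^sup>2) * Im \<omega> + 2 * x * r * (x - Re \<omega>)"
      using half_angle[OF wsq _ rx(1) xw] w2 by simp
    finally show ?thesis unfolding \<omega>_def[symmetric] by (simp add: algebra_simps)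
  qed
  have "A = \<gamma> tp - of_real a * e" using a(2) by (simp add: algebra_simps)
  from that[OF e1 M hu[of tp, folded e_def] a_ge rx(2) r_ge this rx(3) left] show ?thesis .
qed

end

subsection \<open>Behaviour at infinity\<close>

text \<open>For bounded \<open>x\<close> the left side of the inequality grows quadratically in
  \<open>r\<close> and the right side only linearly.\<close>

lemma far_axis_crossing:
  fixes h M X :: real
  assumes "h > 0" "M \<ge> 0" "X \<ge> 0"
  obtains r0 where "\<And>r x d \<omega>. r \<ge> r0 \<Longrightarrow> x > 0 \<Longrightarrow> d \<ge> h \<Longrightarrow> \<bar>\<omega>\<bar> \<le> M \<Longrightarrow>
    (r\<^sup>2 - x\<^sup>2) * d \<le> 2 * x * r * (x - \<omega>) \<Longrightarrow> x > X"
proof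
  fix r x d \<omega> :: real
  define K where "K = X\<^sup>2 * h + 2 * X * (X + M)"
  \<comment> \<open>The three parts of the threshold: \<open>X\<close> keeps the difference of
    squares nonnegative, 1 lets the constant term be absorbed into the linear one, and the last
    makes \<open>r * h\<close> exceed \<open>K\<close>.\<close>
  assume r: "r \<ge> max X (max 1 ((X\<^sup>2 * h + 2 * X * (X + M)) / h + 1))" and x: "x > 0" and d: "d \<ge> h"
    and \<omega>: "\<bar>\<omega>\<bar> \<le> M" and ineq: "(r\<^sup>2 - x\<^sup>2) * d \<le> 2 * x * r * (x - \<omega>)"
  have r1: "r \<ge> X" "r \<ge> 1" "r > K / h" using r by (auto simp: K_def)
  show "x > X"
  proof (rule ccontr)
    assume "\<not> x > X"
    then have xX: "x \<le> X" by simp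
    then have "x\<^sup>2 \<le> X\<^sup>2" using x by (intro power_mono) auto
    moreover have "X\<^sup>2 \<le> r\<^sup>2" using r1 assms by (intro power_mono) auto
    ultimately have "(r\<^sup>2 - X\<^sup>2) * h \<le> (r\<^sup>2 - x\<^sup>2) * d" using d assms by (intro mult_mono) auto
    also note ineq
    also have "2 * x * r * (x - \<omega>) \<le> 2 * x * r * (X + M)"
      using x r1 xX \<omega> by (intro mult_left_mono) auto
    also have "\<dots> \<le> 2 * X * r * (X + M)"
      using x r1 xX assms by (intro mult_right_mono) auto
    finally have "r\<^sup>2 * h \<le> X\<^sup>2 * h * 1 + 2 * X * (X + M) * r" by (simp add: algebra_simps)
    also have "\<dots> \<le> X\<^sup>2 * h * r + 2 * X * (X + M) * r"
      using r1 assms by (intro add_right_mono mult_left_mono) auto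
    finally have "r * (r * h) \<le> r * K" by (simp add: K_def power2_eq_square algebra_simps)
    then have "r * h \<le> K" using r1 by simp
    then show False using r1(3) assms(1) by (simp add: divide_less_eq)
  qed
qed

lemma small_clockwise_rotation:
  fixes y :: complex
  assumes "Re y > 0" "Im y < 0" "- Im y < \<epsilon> * Re y"
  obtains \<rho> \<delta> where "\<rho> > 0" "0 < \<delta>" "\<delta> < \<epsilon>" "y = of_real \<rho> * cis (- \<delta>)"
proof
  define \<tau> where "\<tau> = - Im y / Re y"
  have \<tau>: "\<tau> > 0" using assms by (simp add: \<tau>_def divide_neg_pos)
  have \<tau>_less: "\<tau> < \<epsilon>" unfolding \<tau>_def using assms by (simp only: pos_divide_less_eq)
  have Arg: "Arg y = - arctan \<tau>"
    using assms by (simp add: arg_conv_arctan \<tau>_def arctan_minus[symmetric])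
  show "cmod y > 0" using assms by auto
  show "0 < arctan \<tau>" using \<tau> by simp
  show "arctan \<tau> < \<epsilon>" using \<tau> \<tau>_less arctan_le_self[of \<tau>] by simp
  show "y = of_real (cmod y) * cis (- arctan \<tau>)"
    using rcis_cmod_Arg[of y] unfolding Arg rcis_def by simp
qed

context oval_curve
begin

text \<open>Far from the curve the map is nearly the reflection in \<open>p\<close>, but it always falls short of a half
  turn, because the line from \<open>A\<close> to its image keeps \<open>p\<close> strictly on its left.\<close>
lemma far_step:
  assumes p: "p \<in> interior (oval_domain \<gamma>)" and \<epsilon>: "\<epsilon> > 0"
  obtains R' where "\<And>A. cmod (A - p) > R' \<Longrightarrow> cmod (outer_length_billiard \<gamma> A - p) > R \<and>
    (\<exists>\<rho> \<delta>. \<rho> > 0 \<and> 0 < \<delta> \<and> \<delta> < \<epsilon> \<and>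
       outer_length_billiard \<gamma> A - p = - (of_real \<rho> * cis (- \<delta>) * (A - p)))"
proof -
  obtain M where M: "\<And>t. cmod (\<gamma> t - p) \<le> M" using curve_bounded by blast
  obtain h where h: "h > 0" "\<And>t. Im (cnj (vel \<gamma> t) * (p - \<gamma> t)) \<ge> h * cmod (vel \<gamma> t)"
    using interior_distance_to_tangents[OF p] by blast
  have M0: "M \<ge> 0" using M[of 0] norm_ge_zero order_trans by blast
  \<comment> \<open>\<open>T\<close> bounds the along-axis distances from below:
    \<open>T \<ge> 2 * M\<close> makes the product of two such distances dominate the squared height
    of \<open>p\<close>, and \<open>T * \<epsilon> > 4 * M\<close> makes the rotation defect smaller
    than \<epsilon>.\<close>
  define T where "T = 2 * M + 4 * M / \<epsilon> + 1"
  have "4 * M / \<epsilon> \<ge> 0" using M0 \<epsilon> by simp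
  then have T: "T > 0" "T \<ge> 2 * M" using M0 by (simp_all add: T_def)
  have "T * \<epsilon> = 2 * (M * \<epsilon>) + 4 * M + \<epsilon>" using \<epsilon> by (simp add: T_def field_simps)
  moreover have "M * \<epsilon> \<ge> 0" using M0 \<epsilon> by simp
  ultimately have T\<epsilon>: "T * \<epsilon> > 4 * M" using \<epsilon> by linarith
  \<comment> \<open>Large enough that the image is farther than \<open>R\<close> from
    \<open>p\<close> and its along-axis distance \<xi> is at least \<open>T\<close>.\<close>
  define X where "X = \<bar>R\<bar> + T + M"
  obtain r0 where r0: "\<And>r x d \<omega>. r \<ge> r0 \<Longrightarrow> x > 0 \<Longrightarrow> d \<ge> h \<Longrightarrow> \<bar>\<omega>\<bar> \<le> M \<Longrightarrow>
    (r\<^sup>2 - x\<^sup>2) * d \<le> 2 * x * r * (x - \<omega>) \<Longrightarrow> x > X"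
    using far_axis_crossing[OF h(1) M0, of X] T M0 by (auto simp: X_def)
  show ?thesis
  proof (rule that)
    \<comment> \<open>The bounds serve, in order, \<open>billiard_step\<close>, the estimate
      \<open>\<alpha> \<ge> T\<close>, and \<open>r \<ge> a \<ge> r0\<close>.\<close>
    fix A assume A: "cmod (A - p) > max (3 * M) (max (T + 2 * M) (r0 + M))"
    then have A1: "cmod (A - p) > 3 * M" and A2: "cmod (A - p) > T + 2 * M"
      and A3: "cmod (A - p) > r0 + M" by simp_all
    obtain q e a r x where step: "cmod e = 1" "cmod (q - p) \<le> M" "Im (cnj e * (p - q)) \<ge> h"
      "a \<ge> cmod (A - p) - M" "x > 0" "r \<ge> a" "A = q - of_real a * e"
      "outer_length_billiard \<gamma> A = q + of_real x * e"
      "(r\<^sup>2 - x\<^sup>2) * Im (cnj e * (p - q)) \<le> 2 * x * r * (x - Re (cnj e * (p - q)))"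
      by (rule billiard_step[OF M h(2,1) A1])
    define \<omega> where "\<omega> = cnj e * (p - q)"
    have ee: "cnj e * e = 1" using step(1) by (metis complex_norm_square mult.commute of_real_1 power_one)
    have pq: "p - q = \<omega> * e" using ee by (simp add: \<omega>_def mult_ac)
    have "cmod \<omega> \<le> M" using step(1,2) by (simp add: \<omega>_def norm_mult norm_minus_commute)
    then have \<omega>: "\<bar>Re \<omega>\<bar> \<le> M" "\<bar>Im \<omega>\<bar> \<le> M"
      using abs_Re_le_cmod[of \<omega>] abs_Im_le_cmod[of \<omega>] by linarith+
    have d: "Im \<omega> \<ge> h" using step(3) by (simp only: \<omega>_def)
    have "r \<ge> r0" using A3 step(4,6) by linarith
    then have xX: "x > X"
      using r0[OF _ step(5) d \<omega>(1)] step(9) by (simp only: \<omega>_def)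
    have Bp: "outer_length_billiard \<gamma> A - p = (of_real x - \<omega>) * e"
      using pq by (simp add: step(8) algebra_simps)
    have Ap: "A - p = - ((of_real a + \<omega>) * e)"
      using pq by (subst step(7)) (simp add: algebra_simps)
    have "cmod (of_real x) \<le> cmod (of_real x - \<omega>) + cmod \<omega>" by (metis diff_add_cancel norm_triangle_ineq)
    then have "cmod (of_real x - \<omega>) > R"
      using xX T step(5) \<open>cmod \<omega> \<le> M\<close> by (simp add: X_def)
    then have 1: "cmod (outer_length_billiard \<gamma> A - p) > R" by (simp add: Bp norm_mult step(1))
    define \<alpha> \<xi> where "\<alpha> = a + Re \<omega>" and "\<xi> = x - Re \<omega>"
    have \<alpha>: "\<alpha> \<ge> T" using A2 step(4) \<omega>(1) unfolding \<alpha>_def by linarith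
    have \<xi>: "\<xi> \<ge> T" using xX \<omega>(1) unfolding \<xi>_def X_def by linarith
    define N where "N = \<alpha>\<^sup>2 + (Im \<omega>)\<^sup>2"
    \<comment> \<open>Minus the quotient of the position vectors of the image and of
      \<open>A\<close>, both taken from \<open>p\<close>; its argument is the amount by which the
      step misses a half turn.\<close>
    define y where "y = (of_real x - \<omega>) / (of_real a + \<omega>)"
    have N: "N > 0" using \<alpha> T by (auto simp: N_def intro: add_pos_nonneg)
    have ne: "of_real a + \<omega> \<noteq> 0" using \<alpha> T by (auto simp: complex_eq_iff \<alpha>_def)
    have Rey: "Re y = (\<xi> * \<alpha> - (Im \<omega>)\<^sup>2) / N" and Imy: "Im y = - (Im \<omega> * (\<xi> + \<alpha>)) / N"
      by (simp_all add: y_def Re_divide Im_divide N_def \<alpha>_def \<xi>_def power2_eq_square algebra_simps)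
    have TT: "\<xi> * \<alpha> \<ge> T * T" using \<alpha> \<xi> T by (intro mult_mono) auto
    have "(Im \<omega>)\<^sup>2 \<le> M\<^sup>2" using \<omega>(2) by (simp add: abs_le_square_iff[symmetric])
    moreover have "4 * M\<^sup>2 \<le> T * T"
      using mult_mono[of "2 * M" T "2 * M" T] T M0 by (simp add: power2_eq_square)
    moreover have "T * T > 0" using T by simp
    ultimately have Im2: "4 * (Im \<omega>)\<^sup>2 \<le> \<xi> * \<alpha>" "\<xi> * \<alpha> > 0" using TT by linarith+
    have half: "2 * (\<xi> * \<alpha> - (Im \<omega>)\<^sup>2) \<ge> \<xi> * \<alpha>" using Im2 by (simp add: algebra_simps)
    have pos: "\<xi> * \<alpha> - (Im \<omega>)\<^sup>2 > 0" using Im2 by linarith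
    \<comment> \<open>The determinant of the two position vectors is linear in the distances \<xi>
      and \<alpha>, their inner product quadratic, so the ratio is small.\<close>
    have small: "Im \<omega> * (\<xi> + \<alpha>) < \<epsilon> * (\<xi> * \<alpha> - (Im \<omega>)\<^sup>2)"
    proof -
      have "4 * M * \<alpha> < (\<epsilon> * \<xi>) * \<alpha>" "4 * M * \<xi> < (\<epsilon> * \<alpha>) * \<xi>"
      proof -
        have "T * \<epsilon> \<le> \<epsilon> * \<xi>" "T * \<epsilon> \<le> \<epsilon> * \<alpha>" using \<alpha> \<xi> \<epsilon> by (simp_all add: mult.commute)
        then show "4 * M * \<alpha> < (\<epsilon> * \<xi>) * \<alpha>" "4 * M * \<xi> < (\<epsilon> * \<alpha>) * \<xi>"
          using T T\<epsilon> \<alpha> \<xi> by (auto intro!: mult_strict_right_mono)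
      qed
      then have "4 * (M * (\<xi> + \<alpha>)) < 2 * (\<epsilon> * (\<xi> * \<alpha>))" by (simp add: algebra_simps)
      moreover have "Im \<omega> * (\<xi> + \<alpha>) \<le> M * (\<xi> + \<alpha>)"
        using \<omega>(2) \<alpha> \<xi> T by (intro mult_right_mono) auto
      moreover have "\<epsilon> * (\<xi> * \<alpha>) \<le> \<epsilon> * (2 * (\<xi> * \<alpha> - (Im \<omega>)\<^sup>2))"
        using half \<epsilon> by (intro mult_left_mono) auto
      ultimately show ?thesis by linarith
    qed
    have "Re y > 0" using pos N by (simp add: Rey)
    moreover have "Im y < 0" using N d h(1) \<alpha> \<xi> T by (simp add: Imy)
    moreover have "- Im y < \<epsilon> * Re y"
      using divide_strict_right_mono[OF small N] by (simp add: Rey Imy)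
    ultimately obtain \<rho> \<delta> where "\<rho> > 0" "0 < \<delta>" "\<delta> < \<epsilon>" and y: "y = of_real \<rho> * cis (- \<delta>)"
      by (rule small_clockwise_rotation)
    moreover have "outer_length_billiard \<gamma> A - p = - (y * (A - p))"
      using ne by (simp add: Bp Ap y_def)
    ultimately show "cmod (outer_length_billiard \<gamma> A - p) > R \<and>
        (\<exists>\<rho> \<delta>. \<rho> > 0 \<and> 0 < \<delta> \<and> \<delta> < \<epsilon> \<and>
          outer_length_billiard \<gamma> A - p = - (of_real \<rho> * cis (- \<delta>) * (A - p)))"
      using 1 by blast
  qed
qed

text \<open>The induction peels off the first step, because \<open>far_step\<close> can place its
  image beyond whatever radius the remaining \<open>n\<close> steps require. The defects add up and
  all have the same sign, so they cannot cancel.\<close>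

lemma far_iterates:
  assumes p: "p \<in> interior (oval_domain \<gamma>)" and \<epsilon>: "\<epsilon> > 0"
  shows "\<exists>R. \<forall>A. cmod (A - p) > R \<longrightarrow> (\<exists>\<rho> \<delta>. \<rho> > 0 \<and> 0 \<le> \<delta> \<and> \<delta> \<le> real n * \<epsilon> \<and> (n > 0 \<longrightarrow> \<delta> > 0) \<and>
    (outer_length_billiard \<gamma> ^^ n) A - p = (- 1) ^ n * (of_real \<rho> * cis (- \<delta>) * (A - p)))"
proof (induction n)
  case 0
  show ?case by (rule exI[of _ 0], intro allI impI, rule exI[of _ 1], rule exI[of _ 0]) simp
next
  case (Suc n)
  then obtain R where R: "\<And>A. cmod (A - p) > R \<Longrightarrow> \<exists>\<rho> \<delta>. \<rho> > 0 \<and> 0 \<le> \<delta> \<and> \<delta> \<le> real n * \<epsilon> \<and>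
    (outer_length_billiard \<gamma> ^^ n) A - p = (- 1) ^ n * (of_real \<rho> * cis (- \<delta>) * (A - p))" by blast
  obtain R' where R': "\<And>A. cmod (A - p) > R' \<Longrightarrow> cmod (outer_length_billiard \<gamma> A - p) > R \<and>
    (\<exists>\<rho> \<delta>. \<rho> > 0 \<and> 0 < \<delta> \<and> \<delta> < \<epsilon> \<and>
       outer_length_billiard \<gamma> A - p = - (of_real \<rho> * cis (- \<delta>) * (A - p)))"
    using far_step[OF p \<epsilon>, of R] by blast
  show ?case
  proof (rule exI[of _ R'], intro allI impI)
    fix A assume "cmod (A - p) > R'"
    from R'[OF this] obtain \<rho> \<delta> where far: "cmod (outer_length_billiard \<gamma> A - p) > R"
      and 1: "\<rho> > 0" "0 < \<delta>" "\<delta> < \<epsilon>"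
      "outer_length_billiard \<gamma> A - p = - (of_real \<rho> * cis (- \<delta>) * (A - p))" by blast
    from R[OF far] obtain \<rho>' \<delta>' where 2: "\<rho>' > 0" "0 \<le> \<delta>'" "\<delta>' \<le> real n * \<epsilon>"
      "(outer_length_billiard \<gamma> ^^ n) (outer_length_billiard \<gamma> A) - p =
        (- 1) ^ n * (of_real \<rho>' * cis (- \<delta>') * (outer_length_billiard \<gamma> A - p))" by blast
    have "(outer_length_billiard \<gamma> ^^ Suc n) A - p =
        (- 1) ^ Suc n * (of_real (\<rho>' * \<rho>) * (cis (- \<delta>') * cis (- \<delta>)) * (A - p))"
      using 2(4) unfolding 1(4) by (simp add: funpow_swap1 mult_ac)
    then have "(outer_length_billiard \<gamma> ^^ Suc n) A - p =
        (- 1) ^ Suc n * (of_real (\<rho>' * \<rho>) * cis (- (\<delta>' + \<delta>)) * (A - p))"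
      by (simp only: cis_mult minus_add_distrib)
    then show "\<exists>\<rho> \<delta>. \<rho> > 0 \<and> 0 \<le> \<delta> \<and> \<delta> \<le> real (Suc n) * \<epsilon> \<and> (Suc n > 0 \<longrightarrow> \<delta> > 0) \<and>
        (outer_length_billiard \<gamma> ^^ Suc n) A - p = (- 1) ^ Suc n * (of_real \<rho> * cis (- \<delta>) * (A - p))"
      using 1 2 by (intro exI[of _ "\<rho>' * \<rho>"] exI[of _ "\<delta>' + \<delta>"]) (auto simp: algebra_simps)
  qed
qed

end

section \<open>Exclusion of distant periodic points\<close>

theorem theorem4p15:
  fixes \<gamma> :: "real \<Rightarrow> complex" and Or :: complex and k :: nat
  assumes "oval \<gamma>"
    and "Or \<in> interior (oval_domain \<gamma>)"
    and "k > 0"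
  shows "\<exists>\<rho>::real. \<forall>z. z \<notin> oval_domain \<gamma> \<and> (outer_length_billiard \<gamma> ^^ k) z = z
            \<longrightarrow> cmod (z - Or) \<le> \<rho>"
proof -
  interpret oval_curve \<gamma> by unfold_locales (rule assms(1))
  \<comment> \<open>Keeps the total defect after \<open>k\<close> steps at most 3, which is below
    \<pi>.\<close>
  define \<epsilon> where "\<epsilon> = 3 / real k"
  have \<epsilon>: "\<epsilon> > 0" "real k * \<epsilon> = 3" using assms(3) by (auto simp: \<epsilon>_def)
  obtain R where R: "\<And>A. cmod (A - Or) > R \<Longrightarrow> \<exists>\<rho> \<delta>. \<rho> > 0 \<and> \<delta> \<le> real k * \<epsilon> \<and> \<delta> > 0 \<and>
      (outer_length_billiard \<gamma> ^^ k) A - Or = (- 1) ^ k * (of_real \<rho> * cis (- \<delta>) * (A - Or))"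
    using far_iterates[OF assms(2) \<epsilon>(1), of k] assms(3) by blast
  \<comment> \<open>The cut-off at 0 ensures that \<open>z - Or\<close> is nonzero and can be
    cancelled.\<close>
  have "cmod (z - Or) \<le> max R 0" if z: "(outer_length_billiard \<gamma> ^^ k) z = z" for z
  proof (rule ccontr)
    assume "\<not> cmod (z - Or) \<le> max R 0"
    then have "cmod (z - Or) > R" and ne: "z - Or \<noteq> 0" by auto
    from R[OF this(1)] obtain \<rho> \<delta> where \<rho>: "\<rho> > 0" "\<delta> \<le> 3" "\<delta> > 0"
      "z - Or = (- 1) ^ k * (of_real \<rho> * cis (- \<delta>) * (z - Or))" unfolding z \<epsilon>(2) by blast
    from \<rho>(4) have "((- 1) ^ k * (of_real \<rho> * cis (- \<delta>))) * (z - Or) = 1 * (z - Or)"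
      by (simp add: mult.assoc)
    then have eq: "(- 1) ^ k * (of_real \<rho> * cis (- \<delta>)) = 1" 
      by (rule mult_right_cancel[OF ne, THEN iffD1])
    \<comment> \<open>The sign and the factor \<rho> merely scale the imaginary part, so both
      parities of \<open>k\<close> lead to the same equation.\<close>
    have "sin \<delta> = 0"
      using arg_cong[OF eq, of Im] \<rho>(1) by (cases "even k") auto
    moreover have "sin \<delta> > 0" using \<rho>(2,3) pi_gt3 by (intro sin_gt_zero) auto
    ultimately show False by simp
  qed
  then show ?thesis by blast
qed

end
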